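(* Suppose that $X_i\mid\theta_i\overset{ind}{\sim}N(\theta_i,1)$ and $\theta_i\overset{iid}{\sim}G^*$ for $i=1,\dots,n$, with $G^*\in\mathcal P(\mathbb R)$, so that $X_1,\dots,X_n$ are i.i.d. with density $p_{G^*}(x)=\int\phi(x-\theta)\,dG^*(\theta)$. Let $L>0$ and $\mathcal F_L:=\{f_H:H\in\mathcal P([-L,L])\}$. Suppose that there exist $c_1,c_2>0$ such that $$\int\mathbf 1(|x|>t)\,p_{G^*}(x)\,dx\le c_1e^{-c_2t}\qquad\text{for all }t>0 .$$ Let $\hat H_n$ be the nonparametric maximum likelihood estimator over $\mathcal F_L$, i.e. a maximizer of $\sum_{i=1}^n\log f_H(X_i)$ over $H\in\mathcal P([-L,L])$. Then a pseudo-true density $$f_{\tilde H}=\operatorname*{argmin}_{f\in\mathcal F_L}\mathrm{KL}(p_{G^*}\parallel f)$$ exists and is unique. Moreover, the mixing distribution $\tilde H\in\mathcal P([-L,L])$ is unique. Furthermore, $$\mathfrak H_0^2(f_{\hat H_n},f_{\tilde H})=O_p\Big(\frac{(\log n)^4}{n}\Big).$$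
   Context: $\mathcal P(A)$ is the set of Borel probability measures on $A\subseteq\mathbb R$; $\phi_\sigma$ is the $N(0,\sigma^2)$ density and $\phi=\phi_1$. A constant $c_*\ge0$ is fixed, $\sigma_*^2:=1+c_*^2$, and $f_H(x):=\int\phi_{\sigma_*}(x-\xi)\,dH(\xi)$. The true density $p_{G^*}$ need not be of the form $f_H$ (misspecification). $\mathrm{KL}(p\parallel q)=\int p\log(p/q)$. The divergence $\mathfrak H_0$ is defined by $$\mathfrak H_0^2(f_H,f_{\tilde H}):=\frac12\int\Big(\sqrt{\frac{f_H(x)}{f_{\tilde H}(x)}}-1\Big)^2p_{G^*}(x)\,dx .$$ $O_p$ is with respect to the law of the i.i.d. sample from $p_{G^*}$ as $n\to\infty$. *)

theory Defs
  imports "HOL-Probability.Probability"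
begin

text \<open>Elements of \<open>\<P>(A)\<close> are represented as Borel measures on the whole line giving mass 1 to \<open>A\<close>
  (\<open>A\<close> a Borel set), so that equality of measures is equality of mixing distributions.\<close>

definition borel_probs :: "real set \<Rightarrow> real measure set" where
  "borel_probs A = {H. prob_space H \<and> sets H = sets borel \<and> emeasure H A = 1}"

definition gauss_mixture :: "real \<Rightarrow> real measure \<Rightarrow> real \<Rightarrow> real" where
  "gauss_mixture \<sigma> H x = (\<integral>\<xi>. normal_density 0 \<sigma> (x - \<xi>) \<partial>H)"

abbreviation true_density :: "real measure \<Rightarrow> real \<Rightarrow> real" where
  "true_density G \<equiv> gauss_mixture 1 G"

definition sigma_star :: "real \<Rightarrow> real" where
  "sigma_star c = sqrt (1 + c\<^sup>2)"

abbreviation model_density :: "real \<Rightarrow> real measure \<Rightarrow> real \<Rightarrow> real" where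
  "model_density c H \<equiv> gauss_mixture (sigma_star c) H"

definition model_class :: "real \<Rightarrow> real \<Rightarrow> (real \<Rightarrow> real) set" where
  "model_class c L = model_density c ` borel_probs {-L..L}"

text \<open>For probability densities \<open>p\<close>, \<open>q\<close> with \<open>q > 0\<close> the negative part of \<open>p log (p / q)\<close> is bounded
  by \<open>q\<close>, so non-integrability means that the integral is \<open>\<infinity>\<close>; the real-valued Bochner integral
  (as in the library's \<open>KL_divergence\<close>) would return 0 in that case.\<close>

definition KL_ext :: "(real \<Rightarrow> real) \<Rightarrow> (real \<Rightarrow> real) \<Rightarrow> ereal" where
  "KL_ext p q =
     (if integrable lborel (\<lambda>x. p x * ln (p x / q x))
      then ereal (\<integral>x. p x * ln (p x / q x) \<partial>lborel) else \<infinity>)"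

definition pseudo_true :: "real \<Rightarrow> real \<Rightarrow> real measure \<Rightarrow> (real \<Rightarrow> real) \<Rightarrow> bool" where
  "pseudo_true c L G f \<longleftrightarrow> is_arg_min (KL_ext (true_density G)) (\<lambda>g. g \<in> model_class c L) f"

definition H0_sq :: "(real \<Rightarrow> real) \<Rightarrow> (real \<Rightarrow> real) \<Rightarrow> (real \<Rightarrow> real) \<Rightarrow> ennreal" where
  "H0_sq p f g = (1 / 2) * (\<integral>\<^sup>+x. ennreal ((sqrt (f x / g x) - 1)\<^sup>2 * p x) \<partial>lborel)"

definition is_npmle :: "real \<Rightarrow> real \<Rightarrow> nat \<Rightarrow> (nat \<Rightarrow> real) \<Rightarrow> real measure \<Rightarrow> bool" where
  "is_npmle c L n x H \<longleftrightarrow>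
     H \<in> borel_probs {-L..L} \<and>
     (\<forall>H' \<in> borel_probs {-L..L}.
        (\<Sum>i=1..n. ln (model_density c H' (x i))) \<le> (\<Sum>i=1..n. ln (model_density c H (x i))))"

text \<open>The \<open>\<theta>\<^sub>i\<close> are i.i.d. from \<open>G\<close> and, conditionally on the sigma-algebra generated by
  \<open>(\<theta>\<^sub>1, \<dots>, \<theta>\<^sub>n)\<close>, the \<open>X\<^sub>i\<close> are independent with laws \<open>N(\<theta>\<^sub>i, 1)\<close>.\<close>

definition normal_means_model ::
  "'w measure \<Rightarrow> nat \<Rightarrow> real measure \<Rightarrow> (nat \<Rightarrow> 'w \<Rightarrow> real) \<Rightarrow> (nat \<Rightarrow> 'w \<Rightarrow> real) \<Rightarrow> bool" where
  "normal_means_model M n G \<theta> X \<longleftrightarrow>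
     prob_space M \<and>
     (\<forall>i\<in>{1..n}. \<theta> i \<in> borel_measurable M \<and> X i \<in> borel_measurable M) \<and>
     prob_space.indep_vars M (\<lambda>_. borel) \<theta> {1..n} \<and>
     (\<forall>i\<in>{1..n}. distr M borel (\<theta> i) = G) \<and>
     (\<forall>A. (\<forall>i\<in>{1..n}. A i \<in> sets borel) \<longrightarrow>
        (AE \<omega> in M.
           real_cond_exp M
             (vimage_algebra (space M) (\<lambda>\<omega>. \<lambda>i\<in>{1..n}. \<theta> i \<omega>) (\<Pi>\<^sub>M i\<in>{1..n}. borel))
             (indicator {\<omega> \<in> space M. \<forall>i\<in>{1..n}. X i \<omega> \<in> A i}) \<omega>
           = (\<Prod>i=1..n. measure (density lborel (normal_density (\<theta> i \<omega>) 1)) (A i))))"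

text \<open>\<open>Z\<^sub>n = O\<^sub>p(a\<^sub>n)\<close>, where \<open>Z\<^sub>n\<close> lives on its own probability space \<open>M\<^sub>n\<close>. Phrased with an inner
  event so that it makes sense for \<open>Z\<^sub>n\<close> not known to be measurable; for measurable \<open>Z\<^sub>n\<close> one may
  take \<open>A = {Z\<^sub>n \<le> C a\<^sub>n}\<close>, which gives the usual definition.\<close>

definition bigO_prob ::
  "(nat \<Rightarrow> 'w measure) \<Rightarrow> (nat \<Rightarrow> 'w \<Rightarrow> ennreal) \<Rightarrow> (nat \<Rightarrow> real) \<Rightarrow> bool" where
  "bigO_prob M Z a \<longleftrightarrow>
     (\<forall>\<epsilon>>0. \<exists>C>0. \<forall>\<^sub>F n in sequentially.
        \<exists>A \<in> sets (M n). measure (M n) A \<ge> 1 - \<epsilon> \<and> (\<forall>\<omega>\<in>A. Z n \<omega> \<le> ennreal (C * a n)))"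

end

theory Submission
  imports Defs
begin

text \<open>Write \<open>p\<close> for the true density, \<open>P\<close> for its law, and \<open>f\<^sub>H\<close> for the model density with mixing
distribution \<open>H\<close>.  An exponential tail gives \<open>P\<close> a second moment, and \<open>\<bar>log f\<^sub>H(x)\<bar>\<close> grows at most
quadratically, uniformly in \<open>H\<close>.  All log integrals are therefore finite, and minimising
\<open>KL(p \<parallel> f\<^sub>H)\<close> amounts to maximising the log score \<open>\<integral> log f\<^sub>H dP\<close>.  The mixing distributions on
\<open>[-L, L]\<close> are weakly sequentially compact (Helly) and the score is continuous by dominated
convergence, so a maximiser exists; the logarithm is strictly concave and Gaussian deconvolution is
injective, so it is unique, as a mixing distribution and hence as a density.

For the rate put \<open>u\<^sub>H = f\<^sub>H / f\<^sub>0\<close>, where \<open>f\<^sub>0\<close> is the pseudo-true density.  The model is convex, and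
the first-order condition for the maximiser is \<open>\<integral> u\<^sub>H dP \<le> 1\<close>.  Expanding the square in the
divergence then gives \<open>\<integral> sqrt u\<^sub>H dP \<le> 1 - \<HH>\<^sub>0\<^sup>2(f\<^sub>H, f\<^sub>0)\<close>, which takes the place of the
Hellinger affinity of the well-specified case.  By Markov's inequality applied to
\<open>\<Prod>\<^sub>i sqrt (u\<^sub>H(X\<^sub>i))\<close>, a fixed \<open>H\<close> with \<open>\<HH>\<^sub>0\<^sup>2 \<ge> \<delta>\<close> has nearly as large a likelihood as
\<open>f\<^sub>0\<close> with probability at most \<open>exp(1/2 - n \<delta>)\<close>.

A union bound over a finite net turns this into a statement about the maximum likelihood estimator.
With probability \<open>1 - O(1/n)\<close> the sample lies in \<open>[-T, T]\<close> with \<open>T\<close> a multiple of \<open>log n\<close>.  On that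
interval \<open>f\<^sub>H(x)\<close> is the \<open>N(0, \<sigma>\<^sup>2)\<close> density times a power series in \<open>x L / \<sigma>\<^sup>2\<close> whose
coefficients are bounded moments of \<open>H\<close>.  Rounding \<open>O(log n)\<close> of these moments to a grid of
polynomially small mesh changes \<open>f\<^sub>H\<close> by a factor of at most \<open>1 + 1/n\<close>, hence the likelihood by a
bounded factor.  The net therefore has \<open>exp(O((log n)\<^sup>2))\<close> elements, and choosing \<open>\<delta>\<close> as a large
multiple of \<open>(log n)\<^sup>2 / n\<close> makes the union bound vanish; this is within the rate
\<open>(log n)\<^sup>4 / n\<close>.  The net is formed inside the set of \<open>H\<close> with divergence at least \<open>\<delta>\<close>, so the
divergence need not be compared between neighbouring mixing distributions.

The carrying lemmas are \<open>log_score_maximizer_exists\<close> and \<open>log_score_maximizer_unique\<close> for the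
pseudo-true density, \<open>likelihood_ratio_integral_le_1\<close> for the first-order condition,
\<open>gauss_mixture_ratio_le\<close> for the net, \<open>likelihood_deviation\<close> for the union bound, and
\<open>normal_means_model_iid\<close>, which recovers the law of the sample from the hierarchical model.\<close>

section \<open>Gaussian location mixtures\<close>

lemma borel_probs_iff:
  assumes "A \<in> sets borel"
  shows "H \<in> borel_probs A \<longleftrightarrow> real_distribution H \<and> (AE \<xi> in H. \<xi> \<in> A)"
proof
  assume H: "H \<in> borel_probs A"
  then interpret prob_space H by (auto simp: borel_probs_def)
  have "prob A = 1" using H by (auto simp: borel_probs_def measure_def)
  then have "AE \<xi> in H. \<xi> \<in> A" by (rule AE_prob_1)
  with H show "real_distribution H \<and> (AE \<xi> in H. \<xi> \<in> A)"
    by (auto simp: borel_probs_def real_distribution_def real_distribution_axioms_def)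
next
  assume H: "real_distribution H \<and> (AE \<xi> in H. \<xi> \<in> A)"
  then interpret real_distribution H by auto
  have "emeasure H A = emeasure H (space H)"
    using H assms by (intro emeasure_eq_AE) auto
  with H show "H \<in> borel_probs A"
    by (auto simp: borel_probs_def emeasure_space_1 prob_space_axioms simp del: space_eq_univ)
qed

lemma normal_density_le: "normal_density \<mu> \<sigma> x \<le> 1 / sqrt (2 * pi * \<sigma>\<^sup>2)"
proof -
  have "exp (-(x - \<mu>)\<^sup>2 / (2 * \<sigma>\<^sup>2)) \<le> 1" by simp
  then have "1 / sqrt (2 * pi * \<sigma>\<^sup>2) * exp (-(x - \<mu>)\<^sup>2 / (2 * \<sigma>\<^sup>2)) \<le> 1 / sqrt (2 * pi * \<sigma>\<^sup>2) * 1"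
    by (intro mult_left_mono) auto
  then show ?thesis by (simp add: normal_density_def)
qed

lemma normal_density_shift: "normal_density 0 \<sigma> (x - \<mu>) = normal_density \<mu> \<sigma> x"
  by (simp add: normal_density_def)

context real_distribution
begin

lemma integrable_kernel: "integrable M (\<lambda>\<xi>. normal_density 0 \<sigma> (x - \<xi>))"
  by (rule integrable_const_bound[where B = "1 / sqrt (2 * pi * \<sigma>\<^sup>2)"])
     (auto intro!: normal_density_le)

lemma gauss_mixture_measurable [measurable]: "gauss_mixture \<sigma> M \<in> borel_measurable borel"
  unfolding gauss_mixture_def by measurable

lemma gauss_mixture_nonneg [simp]: "0 \<le> gauss_mixture \<sigma> M x"
  unfolding gauss_mixture_def by (intro Bochner_Integration.integral_nonneg) auto

lemma gauss_mixture_pos: "0 < \<sigma> \<Longrightarrow> 0 < gauss_mixture \<sigma> M x"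
proof -
  assume \<sigma>: "0 < \<sigma>"
  have "gauss_mixture \<sigma> M x \<noteq> 0"
  proof
    assume "gauss_mixture \<sigma> M x = 0"
    then have "AE \<xi> in M. normal_density 0 \<sigma> (x - \<xi>) = 0"
      unfolding gauss_mixture_def
      by (subst (asm) integral_nonneg_eq_0_iff_AE) (auto intro: integrable_kernel)
    moreover have "normal_density 0 \<sigma> (x - \<xi>) \<noteq> 0" for \<xi>
      using normal_density_pos[OF \<sigma>] less_irrefl by metis
    ultimately show False by simp
  qed
  then show ?thesis using gauss_mixture_nonneg[of \<sigma> x] by linarith
qed

lemma gauss_mixture_le: "gauss_mixture \<sigma> M x \<le> 1 / sqrt (2 * pi * \<sigma>\<^sup>2)"
proof -
  have "gauss_mixture \<sigma> M x \<le> (\<integral>\<xi>. 1 / sqrt (2 * pi * \<sigma>\<^sup>2) \<partial>M)"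
    unfolding gauss_mixture_def by (intro integral_mono integrable_kernel normal_density_le) auto
  then show ?thesis by (simp add: prob_space del: space_eq_univ)
qed

lemma gauss_mixture_ge:
  assumes \<sigma>: "0 < \<sigma>" and R: "prob {-R..R} \<ge> 1 / 2"
  shows "gauss_mixture \<sigma> M x \<ge> 1 / 2 * (1 / sqrt (2 * pi * \<sigma>\<^sup>2)) * exp (- (x\<^sup>2 + R\<^sup>2) / \<sigma>\<^sup>2)"
proof -
  let ?c = "(1 / sqrt (2 * pi * \<sigma>\<^sup>2)) * exp (- (x\<^sup>2 + R\<^sup>2) / \<sigma>\<^sup>2)"
  have "1 / 2 * ?c \<le> prob {-R..R} * ?c"
    using R by (intro mult_right_mono) auto
  also have "\<dots> = (\<integral>\<xi>. indicator {-R..R} \<xi> * ?c \<partial>M)"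
    by simp
  also have "\<dots> \<le> gauss_mixture \<sigma> M x"
    unfolding gauss_mixture_def
  proof (intro integral_mono integrable_kernel)
    show "integrable M (\<lambda>\<xi>. indicator {-R..R} \<xi> * ?c)"
      by (intro integrable_mult_left integrable_real_indicator) (auto simp: less_top[symmetric])
  next
    fix \<xi>
    show "indicator {-R..R} \<xi> * ?c \<le> normal_density 0 \<sigma> (x - \<xi>)"
    proof (cases "\<xi> \<in> {-R..R}")
      case True
      then have "\<bar>\<xi>\<bar> \<le> R" by auto
      then have "\<xi>\<^sup>2 \<le> R\<^sup>2"
        by (metis abs_ge_zero power2_abs power_mono)
      moreover have "(x - \<xi>)\<^sup>2 \<le> 2 * x\<^sup>2 + 2 * \<xi>\<^sup>2"
        using zero_le_power2[of "x + \<xi>"] by (simp add: power2_eq_square algebra_simps)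
      ultimately have "(x - \<xi>)\<^sup>2 \<le> 2 * (x\<^sup>2 + R\<^sup>2)"
        unfolding distrib_left by linarith
      then have "- (x\<^sup>2 + R\<^sup>2) / \<sigma>\<^sup>2 \<le> - (x - \<xi>)\<^sup>2 / (2 * \<sigma>\<^sup>2)"
        using \<sigma> by (simp add: divide_simps)
      then show ?thesis
        using True \<sigma> by (simp add: normal_density_def divide_right_mono)
    qed auto
  qed
  finally show ?thesis by simp
qed

text \<open>The upper bound is the height of the kernel.  For the lower bound, half of the mixing mass lies within
\<open>R\<close> of the origin, and there \<open>(x - \<xi>)\<^sup>2 \<le> 2 (x\<^sup>2 + R\<^sup>2)\<close>.  The bound depends on the mixing
distribution only through \<open>R\<close>, so it dominates a whole model class at once and also covers the true
density.\<close>

lemma abs_ln_gauss_mixture_le: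
  assumes \<sigma>: "0 < \<sigma>" and R: "prob {-R..R} \<ge> 1 / 2"
  shows "\<bar>ln (gauss_mixture \<sigma> M x)\<bar> \<le> 1 + \<bar>ln (1 / sqrt (2 * pi * \<sigma>\<^sup>2))\<bar> + (x\<^sup>2 + R\<^sup>2) / \<sigma>\<^sup>2"
proof -
  let ?d = "1 / sqrt (2 * pi * \<sigma>\<^sup>2)"
  have d: "?d > 0" using \<sigma> by simp
  have "ln (gauss_mixture \<sigma> M x) \<le> ln ?d"
    using gauss_mixture_le gauss_mixture_pos[OF \<sigma>] d by (intro ln_mono) auto
  moreover have "ln (1 / 2 * ?d * exp (- (x\<^sup>2 + R\<^sup>2) / \<sigma>\<^sup>2)) \<le> ln (gauss_mixture \<sigma> M x)"
    using gauss_mixture_ge[OF assms, of x] d by (intro ln_mono) auto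
  moreover have "ln (1 / 2 * ?d * exp (- (x\<^sup>2 + R\<^sup>2) / \<sigma>\<^sup>2)) = - ln 2 + ln ?d - (x\<^sup>2 + R\<^sup>2) / \<sigma>\<^sup>2"
  proof -
    have "ln (1 / 2 * ?d * exp y) = ln (1 / 2) + ln ?d + y" for y
      using d by (subst ln_mult_pos, simp, simp, subst ln_mult_pos, simp_all)
    from this[of "- (x\<^sup>2 + R\<^sup>2) / \<sigma>\<^sup>2"]
    show ?thesis
      unfolding minus_divide_left[symmetric] by (simp add: ln_div)
  qed
  moreover have "(x\<^sup>2 + R\<^sup>2) / \<sigma>\<^sup>2 \<ge> 0" by simp
  ultimately show ?thesis using ln_2_less_1 by linarith
qed

text \<open>A mixture density belongs to the law of a normal variable whose mean is drawn first: this is Tonelli's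
theorem, and it serves both for the total mass and for the marginal law in the hierarchical model.\<close>

lemma emeasure_gauss_mixture:
  assumes \<sigma>: "0 < \<sigma>" and A [measurable]: "A \<in> sets borel"
  shows "emeasure (density lborel (gauss_mixture \<sigma> M)) A
       = (\<integral>\<^sup>+\<xi>. emeasure (density lborel (normal_density \<xi> \<sigma>)) A \<partial>M)"
proof -
  interpret pair_sigma_finite lborel M
    by (intro pair_sigma_finite.intro lborel.sigma_finite_measure_axioms sigma_finite_measure_axioms)
  have "emeasure (density lborel (gauss_mixture \<sigma> M)) A
      = (\<integral>\<^sup>+x. \<integral>\<^sup>+\<xi>. ennreal (normal_density 0 \<sigma> (x - \<xi>)) * indicator A x \<partial>M \<partial>lborel)"
    by (subst emeasure_density, simp, simp)
       (auto simp: gauss_mixture_def nn_integral_multc nn_integral_eq_integral integrable_kernel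
             intro!: nn_integral_cong)
  also have "\<dots> = (\<integral>\<^sup>+\<xi>. \<integral>\<^sup>+x. ennreal (normal_density 0 \<sigma> (x - \<xi>)) * indicator A x \<partial>lborel \<partial>M)"
    by (rule Fubini'[symmetric]) measurable
  also have "\<dots> = (\<integral>\<^sup>+\<xi>. emeasure (density lborel (normal_density \<xi> \<sigma>)) A \<partial>M)"
    by (intro nn_integral_cong) (simp add: emeasure_density normal_density_shift)
  finally show ?thesis .
qed

lemma real_distribution_gauss_mixture:
  assumes "0 < \<sigma>"
  shows "real_distribution (density lborel (gauss_mixture \<sigma> M))"
proof -
  have "emeasure (density lborel (gauss_mixture \<sigma> M)) UNIV = (\<integral>\<^sup>+\<xi>. 1 \<partial>M)"
    using prob_space.emeasure_space_1[OF prob_space_normal_density[OF assms]]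
    by (subst emeasure_gauss_mixture[OF assms]) (auto intro!: nn_integral_cong)
  then show ?thesis
    by (auto simp: real_distribution_def real_distribution_axioms_def emeasure_space_1
          simp del: space_eq_univ intro!: prob_spaceI)
qed

text \<open>A mixture is a convolution with a centred normal law, so characteristic functions multiply.\<close>

lemma char_gauss_mixture:
  assumes \<sigma>: "0 < \<sigma>"
  shows "char (density lborel (gauss_mixture \<sigma> M)) t
       = char M t * char (density lborel (normal_density 0 \<sigma>)) t"
proof -
  note sf = sigma_finite_measure_axioms
  interpret pair_sigma_finite lborel M
    by (intro pair_sigma_finite.intro lborel.sigma_finite_measure_axioms sigma_finite_measure_axioms)
  define k where "k x \<xi> = normal_density 0 \<sigma> (x - \<xi>) *\<^sub>R iexp (t * x)" for x \<xi>
  have int: "integrable (lborel \<Otimes>\<^sub>M M) (case_prod k)"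
  proof (rule integrableI_bounded)
    show "case_prod k \<in> borel_measurable (lborel \<Otimes>\<^sub>M M)"
      unfolding k_def by measurable
    have meas: "(\<lambda>z. ennreal (norm (case_prod k z))) \<in> borel_measurable (lborel \<Otimes>\<^sub>M M)"
      unfolding k_def by measurable
    have "(\<integral>\<^sup>+z. ennreal (norm (case_prod k z)) \<partial>(lborel \<Otimes>\<^sub>M M))
        = (\<integral>\<^sup>+x. \<integral>\<^sup>+\<xi>. ennreal (normal_density 0 \<sigma> (x - \<xi>)) \<partial>M \<partial>lborel)"
      by (subst sigma_finite_measure.nn_integral_fst[OF sf meas, symmetric]) (simp add: k_def)
    also have "\<dots> = (\<integral>\<^sup>+x. ennreal (gauss_mixture \<sigma> M x) \<partial>lborel)"
      by (simp add: gauss_mixture_def nn_integral_eq_integral integrable_kernel)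
    also have "\<dots> = emeasure (density lborel (gauss_mixture \<sigma> M)) UNIV"
      by (simp add: emeasure_density)
    also have "\<dots> = 1"
      using prob_space.emeasure_space_1[of "density lborel (gauss_mixture \<sigma> M)"]
        real_distribution_gauss_mixture[OF \<sigma>] by (auto simp: real_distribution_def)
    finally show "(\<integral>\<^sup>+z. ennreal (norm (case_prod k z)) \<partial>(lborel \<Otimes>\<^sub>M M)) < \<infinity>" by simp
  qed
  have inner: "(CLINT x|lborel. k x \<xi>) = iexp (t * \<xi>) * char (density lborel (normal_density 0 \<sigma>)) t" for \<xi>
  proof -
    have "(CLINT x|lborel. k x \<xi>) = (CLINT y|lborel. iexp (t * \<xi>) * (normal_density 0 \<sigma> y *\<^sub>R iexp (t * y)))"
      by (subst lborel_integral_real_affine[where c = 1 and t = \<xi>])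
         (auto simp: k_def scaleR_conv_of_real exp_add algebra_simps)
    also have "\<dots> = iexp (t * \<xi>) * (CLINT y|lborel. normal_density 0 \<sigma> y *\<^sub>R iexp (t * y))"
      by (rule integral_mult_right_zero)
    also have "(CLINT y|lborel. normal_density 0 \<sigma> y *\<^sub>R iexp (t * y))
        = char (density lborel (normal_density 0 \<sigma>)) t"
      unfolding char_def by (subst integral_density) auto
    finally show ?thesis .
  qed
  have "gauss_mixture \<sigma> M x *\<^sub>R iexp (t * x) = (CLINT \<xi>|M. k x \<xi>)" for x
    unfolding k_def gauss_mixture_def by (rule integral_scaleR_left[symmetric]) (rule integrable_kernel)
  then have "char (density lborel (gauss_mixture \<sigma> M)) t = (CLINT x|lborel. CLINT \<xi>|M. k x \<xi>)"
    unfolding char_def by (subst integral_density) auto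
  also have "\<dots> = (CLINT \<xi>|M. CLINT x|lborel. k x \<xi>)"
    by (rule Fubini_integral[OF int, symmetric])
  also have "\<dots> = char M t * char (density lborel (normal_density 0 \<sigma>)) t"
    unfolding inner by (simp add: char_def)
  finally show ?thesis .
qed

end

lemma char_normal:
  assumes "0 < \<sigma>"
  shows "char (density lborel (normal_density 0 \<sigma>)) t = complex_of_real (exp (- (\<sigma> * t)\<^sup>2 / 2))"
proof -
  have "char (density lborel (normal_density 0 \<sigma>)) t
      = (CLINT x|lborel. normal_density 0 \<sigma> x *\<^sub>R iexp (t * x))"
    unfolding char_def by (subst integral_density) auto
  also have "\<dots> = (CLINT y|lborel. \<sigma> *\<^sub>R (normal_density 0 \<sigma> (\<sigma> * y) *\<^sub>R iexp (t * (\<sigma> * y))))"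
    using assms by (subst lborel_integral_real_affine[where c = \<sigma> and t = 0])
      (auto simp del: scaleR_scaleR simp flip: integral_scaleR_right)
  also have "\<dots> = (CLINT y|lborel. std_normal_density y *\<^sub>R iexp ((\<sigma> * t) * y))"
  proof (rule Bochner_Integration.integral_cong[OF refl])
    fix y
    have "\<sigma> * normal_density 0 \<sigma> (\<sigma> * y) = std_normal_density y"
      using assms by (simp add: normal_density_def power_mult_distrib real_sqrt_mult)
    then show "\<sigma> *\<^sub>R (normal_density 0 \<sigma> (\<sigma> * y) *\<^sub>R iexp (t * (\<sigma> * y)))
        = std_normal_density y *\<^sub>R iexp ((\<sigma> * t) * y)"
      by (simp add: mult_ac)
  qed
  also have "\<dots> = char std_normal_distribution (\<sigma> * t)"
    unfolding char_def by (subst integral_density) auto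
  finally show ?thesis by (simp add: char_std_normal_distribution)
qed

text \<open>Deconvolution: the normal characteristic function has no zeros, so it can be cancelled, and
Levy's theorem recovers the mixing distribution.\<close>

lemma gauss_mixture_inj:
  assumes \<sigma>: "0 < \<sigma>" and H: "real_distribution H" "real_distribution H'"
    and eq: "AE x in lborel. gauss_mixture \<sigma> H x = gauss_mixture \<sigma> H' x"
  shows "H = H'"
proof (rule Levy_uniqueness[OF H], rule ext)
  fix t
  note [measurable] = real_distribution.gauss_mixture_measurable[OF H(1)]
    real_distribution.gauss_mixture_measurable[OF H(2)]
  have "density lborel (gauss_mixture \<sigma> H) = density lborel (gauss_mixture \<sigma> H')"
    using eq by (intro density_cong) (auto elim!: eventually_mono)
  with real_distribution.char_gauss_mixture[OF H(1) \<sigma>, of t]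
    real_distribution.char_gauss_mixture[OF H(2) \<sigma>, of t]
  show "char H t = char H' t"
    by (simp add: char_normal[OF \<sigma>])
qed

section \<open>Finite nets of mixtures for likelihood ratios\<close>

lemma power_div_fact_le_exp:
  assumes "0 \<le> (x::real)"
  shows "x ^ n / fact n \<le> exp x"
proof -
  obtain t where t: "exp x = (\<Sum>m<Suc n. x ^ m / fact m) + exp t / fact (Suc n) * x ^ Suc n"
    using Maclaurin_exp_le[of x "Suc n"] by blast
  have "x ^ n / fact n \<le> (\<Sum>m<Suc n. x ^ m / fact m)"
    using assms by (simp add: sum_nonneg)
  also have "\<dots> \<le> exp x"
    using assms by (subst t) simp
  finally show ?thesis .
qed

text \<open>The remainder is at most \<open>exp Z\<close> times \<open>Z ^ m / m!\<close>, and \<open>m ^ m / m! \<le> exp m\<close>.  Taking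
\<open>m \<ge> exp 2 * Z\<close> leaves a factor \<open>exp (- 2 m)\<close> from \<open>(Z / m) ^ m\<close>, so the remainder decays
exponentially once the number of terms exceeds a multiple of \<open>Z\<close>.\<close>

lemma exp_taylor_remainder:
  fixes y Z :: real
  assumes y: "\<bar>y\<bar> \<le> Z" and m: "exp 2 * Z \<le> real m"
  shows "\<bar>exp y - (\<Sum>k<m. y ^ k / fact k)\<bar> \<le> exp Z * exp (- real m)"
proof -
  obtain t where t: "\<bar>t\<bar> \<le> \<bar>y\<bar>" "exp y = (\<Sum>k<m. y ^ k / fact k) + exp t / fact m * y ^ m"
    using Maclaurin_exp_le[of y m] by blast
  have "\<bar>y\<bar> ^ m \<le> (real m * exp (- 2)) ^ m"
  proof (rule power_mono)
    have "Z \<le> real m * exp (- 2)" using m by (simp add: exp_minus field_simps)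
    then show "\<bar>y\<bar> \<le> real m * exp (- 2)" using y by linarith
  qed simp
  also have "\<dots> = exp (- 2 * real m) * real m ^ m"
    by (simp add: power_mult_distrib exp_of_nat_mult[symmetric] mult.commute)
  finally have "\<bar>y\<bar> ^ m / fact m \<le> exp (- 2 * real m) * (real m ^ m / fact m)"
    by (simp add: divide_right_mono)
  also have "\<dots> \<le> exp (- 2 * real m) * exp (real m)"
    by (intro mult_left_mono power_div_fact_le_exp) auto
  also have "\<dots> = exp (- real m)" by (simp add: exp_add[symmetric])
  finally have *: "\<bar>y\<bar> ^ m / fact m \<le> exp (- real m)" .
  have "\<bar>exp y - (\<Sum>k<m. y ^ k / fact k)\<bar> = exp t * (\<bar>y\<bar> ^ m / fact m)"
    unfolding t(2) by (simp add: abs_mult power_abs)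
  also have "\<dots> \<le> exp Z * exp (- real m)"
    using t(1) y * by (intro mult_mono) auto
  finally show ?thesis .
qed

text \<open>Rounding \<open>m\<close> coordinates in \<open>[-1, 1]\<close> down to multiples of \<open>1 / N\<close> splits \<open>S\<close> into at most
\<open>(2 N + 1) ^ m\<close> cells.  One point per nonempty cell is a net that lies in \<open>S\<close> itself; later \<open>S\<close> is
the set of mixing distributions to be excluded, and every net point must inherit that property.\<close>

lemma finite_mesh_net:
  fixes a :: "'h \<Rightarrow> nat \<Rightarrow> real" and N :: nat
  assumes N: "0 < N" and a: "\<And>h k. h \<in> S \<Longrightarrow> k < m \<Longrightarrow> \<bar>a h k\<bar> \<le> 1"
  obtains J where "J \<subseteq> S" "finite J" "card J \<le> (2 * N + 1) ^ m"
    "\<And>h. h \<in> S \<Longrightarrow> \<exists>j\<in>J. \<forall>k<m. \<bar>a h k - a j k\<bar> \<le> 1 / real N"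
proof -
  define cell where "cell h = (\<lambda>k\<in>{..<m}. \<lfloor>real N * a h k\<rfloor>)" for h
  define B where "B = (PiE {..<m} (\<lambda>_. {- int N..int N}))"
  define J where "J = inv_into S cell ` (cell ` S)"
  have "cell ` S \<subseteq> B"
  proof
    fix c assume "c \<in> cell ` S"
    then obtain h where h: "h \<in> S" "c = cell h" by blast
    have "\<lfloor>real N * a h k\<rfloor> \<in> {- int N..int N}" if "k < m" for k
    proof -
      from a[OF h(1) that] have "- 1 \<le> a h k" "a h k \<le> 1" by auto
      then have "real N * (- 1) \<le> real N * a h k" "real N * a h k \<le> real N * 1"
        by (intro mult_left_mono; simp)+
      then show ?thesis by (simp add: le_floor_iff floor_le_iff)
    qed
    then show "c \<in> B" by (auto simp: h cell_def B_def)
  qed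
  moreover have B: "finite B" by (simp add: B_def finite_PiE)
  ultimately have fin: "finite (cell ` S)" and "card (cell ` S) \<le> card B"
    by (auto intro: finite_subset card_mono)
  moreover have "card B = (2 * N + 1) ^ m"
    by (simp add: B_def card_PiE nat_add_distrib nat_mult_distrib algebra_simps)
  moreover have "card J \<le> card (cell ` S)" unfolding J_def by (rule card_image_le[OF fin])
  ultimately have card: "card J \<le> (2 * N + 1) ^ m" by simp
  show thesis
  proof (rule that[OF _ _ card])
    show "J \<subseteq> S" by (auto simp: J_def intro: inv_into_into)
    show "finite J" using fin by (simp add: J_def)
    fix h assume h: "h \<in> S"
    define j where "j = inv_into S cell (cell h)"
    have "j \<in> J" using h by (auto simp: j_def J_def)
    moreover have "\<bar>a h k - a j k\<bar> \<le> 1 / real N" if "k < m" for k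
    proof -
      have "cell j = cell h" unfolding j_def using h by (intro f_inv_into_f) auto
      then have "\<lfloor>real N * a j k\<rfloor> = \<lfloor>real N * a h k\<rfloor>"
        using that by (auto simp: cell_def restrict_def fun_eq_iff split: if_splits)
      then have "\<bar>real N * a h k - real N * a j k\<bar> \<le> 1" by linarith
      then have "real N * \<bar>a h k - a j k\<bar> \<le> 1"
        by (simp add: abs_mult flip: right_diff_distrib)
      then show ?thesis using N by (simp add: field_simps)
    qed
    ultimately show "\<exists>j\<in>J. \<forall>k<m. \<bar>a h k - a j k\<bar> \<le> 1 / real N" by blast
  qed
qed

text \<open>Expanding \<open>(x - \<xi>)\<^sup>2\<close> factors the kernel into the centred normal density at \<open>x\<close>, the factor
\<open>exp (- \<xi>\<^sup>2 / (2 \<sigma>\<^sup>2))\<close> and \<open>exp (x \<xi> / \<sigma>\<^sup>2)\<close>.  These moments are the coefficients that remain when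
the last factor is expanded in powers of \<open>x L / \<sigma>\<^sup>2\<close>.  Scaling by \<open>L\<close> puts all of them in
\<open>[-1, 1]\<close>.\<close>

definition gauss_coeff :: "real \<Rightarrow> real \<Rightarrow> real measure \<Rightarrow> nat \<Rightarrow> real" where
  "gauss_coeff \<sigma> L H k = (\<integral>\<xi>. (\<xi> / L) ^ k * exp (- \<xi>\<^sup>2 / (2 * \<sigma>\<^sup>2)) \<partial>H)"

text \<open>The ratio of a mixture to the centred normal density (see the next lemma).  For mixing distributions on
\<open>[-L, L]\<close> it is at least \<open>exp (- O(\<bar>x\<bar>))\<close>, whereas the mixture itself is only at least
\<open>exp (- O(x\<^sup>2))\<close>.  An approximation of the tilt to polynomial accuracy is therefore accurate in ratio
when \<open>\<bar>x\<bar>\<close> is of order \<open>log n\<close>.\<close>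

definition gauss_tilt :: "real \<Rightarrow> real measure \<Rightarrow> real \<Rightarrow> real" where
  "gauss_tilt \<sigma> H x = (\<integral>\<xi>. exp (x * \<xi> / \<sigma>\<^sup>2) * exp (- \<xi>\<^sup>2 / (2 * \<sigma>\<^sup>2)) \<partial>H)"

lemma gauss_mixture_eq_tilt: "gauss_mixture \<sigma> H x = normal_density 0 \<sigma> x * gauss_tilt \<sigma> H x"
proof -
  have "normal_density 0 \<sigma> (x - \<xi>)
      = normal_density 0 \<sigma> x * (exp (x * \<xi> / \<sigma>\<^sup>2) * exp (- \<xi>\<^sup>2 / (2 * \<sigma>\<^sup>2)))" for \<xi>
  proof -
    have "- (x - \<xi>)\<^sup>2 / (2 * \<sigma>\<^sup>2) = - x\<^sup>2 / (2 * \<sigma>\<^sup>2) + (x * \<xi> / \<sigma>\<^sup>2 + - \<xi>\<^sup>2 / (2 * \<sigma>\<^sup>2))"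
      by (cases "\<sigma> = 0") (simp_all add: field_simps power2_eq_square)
    then have "exp (- (x - \<xi>)\<^sup>2 / (2 * \<sigma>\<^sup>2))
        = exp (- x\<^sup>2 / (2 * \<sigma>\<^sup>2)) * (exp (x * \<xi> / \<sigma>\<^sup>2) * exp (- \<xi>\<^sup>2 / (2 * \<sigma>\<^sup>2)))"
      by (simp only: exp_add)
    then show ?thesis by (simp add: normal_density_def)
  qed
  then show ?thesis by (simp add: gauss_mixture_def gauss_tilt_def)
qed

lemma gauss_coeff_integrable:
  assumes H: "real_distribution H" "AE \<xi> in H. \<xi> \<in> {-L..L}" and L: "L > 0"
  shows "integrable H (\<lambda>\<xi>. (\<xi> / L) ^ k * exp (- \<xi>\<^sup>2 / (2 * \<sigma>\<^sup>2)))"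
    and "\<bar>gauss_coeff \<sigma> L H k\<bar> \<le> 1"
proof -
  interpret real_distribution H by fact
  have bound: "\<bar>(\<xi> / L) ^ k * exp (- \<xi>\<^sup>2 / (2 * \<sigma>\<^sup>2))\<bar> \<le> 1" if "\<xi> \<in> {-L..L}" for \<xi>
  proof -
    have "\<bar>\<xi> / L\<bar> ^ k \<le> 1" using that L by (intro power_le_one) (auto simp: abs_le_iff)
    moreover have "exp (- \<xi>\<^sup>2 / (2 * \<sigma>\<^sup>2)) \<le> 1" by simp
    ultimately have "\<bar>\<xi> / L\<bar> ^ k * exp (- \<xi>\<^sup>2 / (2 * \<sigma>\<^sup>2)) \<le> 1 * 1"
      by (intro mult_mono) auto
    then show ?thesis by (simp add: abs_mult power_abs)
  qed
  show int: "integrable H (\<lambda>\<xi>. (\<xi> / L) ^ k * exp (- \<xi>\<^sup>2 / (2 * \<sigma>\<^sup>2)))"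
    using bound by (intro integrable_const_bound[where B = 1] eventually_mono[OF H(2)]) auto
  have "\<bar>gauss_coeff \<sigma> L H k\<bar> \<le> (\<integral>\<xi>. \<bar>(\<xi> / L) ^ k * exp (- \<xi>\<^sup>2 / (2 * \<sigma>\<^sup>2))\<bar> \<partial>H)"
    unfolding gauss_coeff_def by (rule integral_abs_bound)
  also have "\<dots> \<le> (\<integral>\<xi>. 1 \<partial>H)"
    using bound by (intro integral_mono_AE integrable_abs int eventually_mono[OF H(2)]) auto
  finally show "\<bar>gauss_coeff \<sigma> L H k\<bar> \<le> 1" by (simp add: prob_space del: space_eq_univ)
qed

text \<open>Here \<open>Z\<close> bounds the exponent \<open>x \<xi> / \<sigma>\<^sup>2\<close> over the support; the Taylor estimate is
integrated against \<open>H\<close>.\<close>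

lemma gauss_tilt_approx:
  assumes H: "real_distribution H" "AE \<xi> in H. \<xi> \<in> {-L..L}" and L: "L > 0" and \<sigma>: "\<sigma> > 0"
    and Z: "\<bar>x\<bar> * L / \<sigma>\<^sup>2 \<le> Z" and m: "exp 2 * Z \<le> real m"
  shows "\<bar>gauss_tilt \<sigma> H x - (\<Sum>k<m. (x * L / \<sigma>\<^sup>2) ^ k / fact k * gauss_coeff \<sigma> L H k)\<bar>
           \<le> exp Z * exp (- real m)"
    and "exp (- Z - L\<^sup>2 / (2 * \<sigma>\<^sup>2)) \<le> gauss_tilt \<sigma> H x"
proof -
  interpret real_distribution H by fact
  let ?e = "\<lambda>\<xi>. exp (- \<xi>\<^sup>2 / (2 * \<sigma>\<^sup>2))" and ?z = "x * L / \<sigma>\<^sup>2"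
  have y: "\<bar>x * \<xi> / \<sigma>\<^sup>2\<bar> \<le> Z" if "\<xi> \<in> {-L..L}" for \<xi>
  proof -
    have "\<bar>x * \<xi> / \<sigma>\<^sup>2\<bar> \<le> \<bar>x\<bar> * L / \<sigma>\<^sup>2"
      using that by (auto simp: abs_mult intro!: divide_right_mono mult_left_mono)
    with Z show ?thesis by linarith
  qed
  have int: "integrable H (\<lambda>\<xi>. exp (x * \<xi> / \<sigma>\<^sup>2) * ?e \<xi>)"
  proof (rule integrable_const_bound[where B = "exp Z * 1"])
    show "AE \<xi> in H. norm (exp (x * \<xi> / \<sigma>\<^sup>2) * ?e \<xi>) \<le> exp Z * 1"
      using H(2)
    proof eventually_elim
      case (elim \<xi>)
      then have "exp (x * \<xi> / \<sigma>\<^sup>2) * ?e \<xi> \<le> exp Z * 1"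
        using abs_le_D1[OF y[OF elim]] by (intro mult_mono) auto
      then show ?case by simp
    qed
  qed simp
  define g where "g \<xi> = exp (x * \<xi> / \<sigma>\<^sup>2) * ?e \<xi>" for \<xi>
  define h where "h k \<xi> = ?z ^ k / fact k * ((\<xi> / L) ^ k * ?e \<xi>)" for k \<xi>
  have g: "integrable H g" unfolding g_def by (rule int)
  have h: "integrable H (h k)" for k
    unfolding h_def by (intro integrable_mult_right gauss_coeff_integrable H L)
  have "(\<integral>\<xi>. h k \<xi> \<partial>H) = ?z ^ k / fact k * gauss_coeff \<sigma> L H k" for k
    unfolding h_def gauss_coeff_def by (rule integral_mult_right_zero)
  moreover have "gauss_tilt \<sigma> H x = (\<integral>\<xi>. g \<xi> \<partial>H)"
    unfolding gauss_tilt_def g_def ..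
  ultimately have "gauss_tilt \<sigma> H x - (\<Sum>k<m. ?z ^ k / fact k * gauss_coeff \<sigma> L H k)
      = (\<integral>\<xi>. g \<xi> - (\<Sum>k<m. h k \<xi>) \<partial>H)"
    using g h by simp
  also have "\<bar>\<dots>\<bar> \<le> (\<integral>\<xi>. \<bar>g \<xi> - (\<Sum>k<m. h k \<xi>)\<bar> \<partial>H)"
    by (rule integral_abs_bound)
  also have "\<dots> \<le> (\<integral>\<xi>. exp Z * exp (- real m) \<partial>H)"
  proof (rule integral_mono_AE)
    show "integrable H (\<lambda>\<xi>. \<bar>g \<xi> - (\<Sum>k<m. h k \<xi>)\<bar>)"
      using g h by (intro integrable_abs Bochner_Integration.integrable_diff Bochner_Integration.integrable_sum)
    show "AE \<xi> in H. \<bar>g \<xi> - (\<Sum>k<m. h k \<xi>)\<bar> \<le> exp Z * exp (- real m)"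
      using H(2)
    proof eventually_elim
      case (elim \<xi>)
      let ?y = "x * \<xi> / \<sigma>\<^sup>2"
      have "h k \<xi> = ?y ^ k / fact k * ?e \<xi>" for k
      proof -
        have "?z ^ k * (\<xi> / L) ^ k = ?y ^ k"
          using L by (simp flip: power_mult_distrib)
        then show ?thesis by (simp add: h_def mult.assoc[symmetric])
      qed
      then have "g \<xi> - (\<Sum>k<m. h k \<xi>)
          = (exp ?y - (\<Sum>k<m. ?y ^ k / fact k)) * ?e \<xi>"
        by (simp add: g_def left_diff_distrib sum_distrib_right)
      also have "\<bar>\<dots>\<bar> \<le> (exp Z * exp (- real m)) * 1"
        unfolding abs_mult using exp_taylor_remainder[OF y[OF elim] m] by (intro mult_mono) auto
      finally show ?case by simp
    qed
  qed simp
  finally show "\<bar>gauss_tilt \<sigma> H x - (\<Sum>k<m. ?z ^ k / fact k * gauss_coeff \<sigma> L H k)\<bar>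
           \<le> exp Z * exp (- real m)"
    by (simp add: prob_space del: space_eq_univ)
  have "exp (- Z - L\<^sup>2 / (2 * \<sigma>\<^sup>2)) = (\<integral>\<xi>. exp (- Z - L\<^sup>2 / (2 * \<sigma>\<^sup>2)) \<partial>H)"
    by (simp add: prob_space del: space_eq_univ)
  also have "\<dots> \<le> gauss_tilt \<sigma> H x"
    unfolding gauss_tilt_def
  proof (rule integral_mono_AE[OF _ int])
    show "AE \<xi> in H. exp (- Z - L\<^sup>2 / (2 * \<sigma>\<^sup>2)) \<le> exp (x * \<xi> / \<sigma>\<^sup>2) * ?e \<xi>"
      using H(2)
    proof eventually_elim
      case (elim \<xi>)
      then have "\<xi>\<^sup>2 \<le> L\<^sup>2" by (intro abs_le_square_iff[THEN iffD1]) auto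
      then have "\<xi>\<^sup>2 / (2 * \<sigma>\<^sup>2) \<le> L\<^sup>2 / (2 * \<sigma>\<^sup>2)" by (intro divide_right_mono) auto
      moreover have "- Z \<le> x * \<xi> / \<sigma>\<^sup>2"
        using abs_le_D2[OF y[OF elim]] by (subst minus_le_iff)
      ultimately have "- Z - L\<^sup>2 / (2 * \<sigma>\<^sup>2) \<le> x * \<xi> / \<sigma>\<^sup>2 + - \<xi>\<^sup>2 / (2 * \<sigma>\<^sup>2)" by simp
      then show ?case by (simp flip: exp_add)
    qed
  qed simp
  finally show "exp (- Z - L\<^sup>2 / (2 * \<sigma>\<^sup>2)) \<le> gauss_tilt \<sigma> H x" .
qed

text \<open>Close coefficients give an additive error for the tilts of size \<open>(\<eta> + 2 exp (- m)) exp Z\<close>; dividing by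
their lower bound \<open>exp (- Z - L\<^sup>2 / (2 \<sigma>\<^sup>2))\<close> makes it multiplicative, which is the form that
controls a likelihood ratio.\<close>

lemma gauss_mixture_ratio_le:
  assumes H: "real_distribution H" "AE \<xi> in H. \<xi> \<in> {-L..L}"
    and H': "real_distribution H'" "AE \<xi> in H'. \<xi> \<in> {-L..L}" and L: "L > 0" and \<sigma>: "\<sigma> > 0"
    and Z: "\<bar>x\<bar> * L / \<sigma>\<^sup>2 \<le> Z" and m: "exp 2 * Z \<le> real m"
    and \<eta>0: "0 \<le> \<eta>" and close: "\<And>k. k < m \<Longrightarrow> \<bar>gauss_coeff \<sigma> L H k - gauss_coeff \<sigma> L H' k\<bar> \<le> \<eta>"
    and \<eta>: "(\<eta> + 2 * exp (- real m)) * exp (2 * Z + L\<^sup>2 / (2 * \<sigma>\<^sup>2)) \<le> \<epsilon>"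
  shows "gauss_mixture \<sigma> H x \<le> (1 + \<epsilon>) * gauss_mixture \<sigma> H' x"
proof -
  let ?z = "x * L / \<sigma>\<^sup>2" and ?B = "L\<^sup>2 / (2 * \<sigma>\<^sup>2)"
  let ?S = "\<lambda>H. \<Sum>k<m. ?z ^ k / fact k * gauss_coeff \<sigma> L H k"
  have z: "\<bar>?z\<bar> \<le> Z" using Z L by (simp add: abs_mult)
  have "?S H - ?S H' = (\<Sum>k<m. ?z ^ k / fact k * (gauss_coeff \<sigma> L H k - gauss_coeff \<sigma> L H' k))"
    by (simp add: sum_subtractf right_diff_distrib)
  also have "\<dots> \<le> (\<Sum>k<m. \<bar>?z\<bar> ^ k / fact k * \<eta>)"
  proof (rule sum_mono)
    fix k assume "k \<in> {..<m}"
    then have "\<bar>?z ^ k / fact k\<bar> * \<bar>gauss_coeff \<sigma> L H k - gauss_coeff \<sigma> L H' k\<bar> \<le> \<bar>?z ^ k / fact k\<bar> * \<eta>"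
      using close by (intro mult_left_mono) auto
    then have "\<bar>?z ^ k / fact k * (gauss_coeff \<sigma> L H k - gauss_coeff \<sigma> L H' k)\<bar> \<le> \<bar>?z\<bar> ^ k / fact k * \<eta>"
      by (simp add: abs_mult power_abs)
    then show "?z ^ k / fact k * (gauss_coeff \<sigma> L H k - gauss_coeff \<sigma> L H' k) \<le> \<bar>?z\<bar> ^ k / fact k * \<eta>"
      by linarith
  qed
  also have "\<dots> = \<eta> * (\<Sum>k<m. \<bar>?z\<bar> ^ k / fact k)"
    by (simp add: sum_distrib_left mult.commute)
  also have "\<dots> \<le> \<eta> * exp Z"
  proof (rule mult_left_mono[OF _ \<eta>0])
    obtain t where "exp \<bar>?z\<bar> = (\<Sum>k<m. \<bar>?z\<bar> ^ k / fact k) + exp t / fact m * \<bar>?z\<bar> ^ m"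
      using Maclaurin_exp_le[of "\<bar>?z\<bar>" m] by blast
    then have "(\<Sum>k<m. \<bar>?z\<bar> ^ k / fact k) \<le> exp \<bar>?z\<bar>" by simp
    also have "\<dots> \<le> exp Z" using z by simp
    finally show "(\<Sum>k<m. \<bar>?z\<bar> ^ k / fact k) \<le> exp Z" .
  qed
  finally have S: "?S H - ?S H' \<le> \<eta> * exp Z" .
  note T = gauss_tilt_approx[OF H L \<sigma> Z m] and T' = gauss_tilt_approx[OF H' L \<sigma> Z m]
  have "gauss_tilt \<sigma> H x \<le> gauss_tilt \<sigma> H' x + (\<eta> + 2 * exp (- real m)) * exp Z"
    using T(1) T'(1) S by (simp add: algebra_simps abs_le_iff)
  also have "(\<eta> + 2 * exp (- real m)) * exp Z
      = (\<eta> + 2 * exp (- real m)) * exp (2 * Z + ?B) * exp (- Z - ?B)"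
    by (simp add: mult.assoc flip: exp_add)
  also have "\<dots> \<le> \<epsilon> * gauss_tilt \<sigma> H' x"
  proof (rule mult_mono[OF \<eta> T'(2)])
    have "0 \<le> (\<eta> + 2 * exp (- real m)) * exp (2 * Z + ?B)" using \<eta>0 by simp
    with \<eta> show "0 \<le> \<epsilon>" by linarith
  qed simp
  finally have "gauss_tilt \<sigma> H x \<le> (1 + \<epsilon>) * gauss_tilt \<sigma> H' x" by (simp add: algebra_simps)
  then have "normal_density 0 \<sigma> x * gauss_tilt \<sigma> H x \<le> normal_density 0 \<sigma> x * ((1 + \<epsilon>) * gauss_tilt \<sigma> H' x)"
    by (intro mult_left_mono) auto
  then show ?thesis by (simp add: gauss_mixture_eq_tilt mult_ac)
qed

section \<open>The log score and its maximiser\<close>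

text \<open>The mixture of two mixing distributions is realised by tossing a coin with success probability \<open>t\<close>
and then drawing from the distribution that it selects.\<close>

lemma borel_probs_convex:
  assumes A: "A \<in> sets borel" and H: "H \<in> borel_probs A" "H' \<in> borel_probs A" and t: "0 \<le> t" "t \<le> 1"
  shows "\<exists>K \<in> borel_probs A. \<forall>\<sigma> x. gauss_mixture \<sigma> K x = (1 - t) * gauss_mixture \<sigma> H x + t * gauss_mixture \<sigma> H' x"
proof -
  interpret H: real_distribution H using H(1) A by (simp add: borel_probs_iff)
  interpret H': real_distribution H' using H(2) A by (simp add: borel_probs_iff)
  define B where "B = measure_pmf (bernoulli_pmf t)"
  define N where "N b = (if b then H' else H)" for b :: bool
  interpret B: prob_space B unfolding B_def by (rule prob_space_measure_pmf)
  have spN: "N b \<in> space (subprob_algebra borel)" for b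
    by (auto simp: N_def space_subprob_algebra intro: H.subprob_space_axioms H'.subprob_space_axioms)
  have N: "N \<in> measurable B (subprob_algebra borel)"
    using spN by (auto simp: B_def measurable_def)
  define K where "K = B \<bind> N"
  have nn: "(\<integral>\<^sup>+x. f x \<partial>K) = ennreal (1 - t) * (\<integral>\<^sup>+x. f x \<partial>H) + ennreal t * (\<integral>\<^sup>+x. f x \<partial>H')"
    if "f \<in> borel_measurable borel" for f
    using t unfolding K_def nn_integral_bind[OF that N]
    by (simp add: B_def N_def mult.commute add.commute)
  have sets: "sets K = sets borel" unfolding K_def
    by (rule sets_bind) (use sets_kernel[OF N] in \<open>auto simp: B_def\<close>)
  have em: "emeasure K C = ennreal (1 - t) * emeasure H C + ennreal t * emeasure H' C" if "C \<in> sets borel" for C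
    using nn[of "indicator C"] that by (simp add: sets)
  have one: "ennreal (1 - t) + ennreal t = 1" using t by (simp flip: ennreal_plus)
  have "emeasure K UNIV = 1"
    using em[of UNIV] one H.emeasure_space_1 H'.emeasure_space_1 by simp
  then have "prob_space K"
    using sets_eq_imp_space_eq[OF sets] by (intro prob_spaceI) simp
  moreover have "emeasure K A = 1"
    using em[OF A] one H by (auto simp: borel_probs_def)
  ultimately have K: "K \<in> borel_probs A" by (auto simp: borel_probs_def sets)
  interpret K: real_distribution K using K A by (simp add: borel_probs_iff)
  have "gauss_mixture \<sigma> K x = (1 - t) * gauss_mixture \<sigma> H x + t * gauss_mixture \<sigma> H' x" for \<sigma> x
  proof -
    have "ennreal (gauss_mixture \<sigma> K x) = (\<integral>\<^sup>+\<xi>. ennreal (normal_density 0 \<sigma> (x - \<xi>)) \<partial>K)"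
      unfolding gauss_mixture_def by (intro nn_integral_eq_integral[symmetric] K.integrable_kernel) auto
    also have "\<dots> = ennreal (1 - t) * (\<integral>\<^sup>+\<xi>. ennreal (normal_density 0 \<sigma> (x - \<xi>)) \<partial>H)
        + ennreal t * (\<integral>\<^sup>+\<xi>. ennreal (normal_density 0 \<sigma> (x - \<xi>)) \<partial>H')"
      by (rule nn) measurable
    also have "(\<integral>\<^sup>+\<xi>. ennreal (normal_density 0 \<sigma> (x - \<xi>)) \<partial>H) = ennreal (gauss_mixture \<sigma> H x)"
      unfolding gauss_mixture_def by (intro nn_integral_eq_integral H.integrable_kernel) auto
    also have "(\<integral>\<^sup>+\<xi>. ennreal (normal_density 0 \<sigma> (x - \<xi>)) \<partial>H') = ennreal (gauss_mixture \<sigma> H' x)"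
      unfolding gauss_mixture_def by (intro nn_integral_eq_integral H'.integrable_kernel) auto
    finally show ?thesis
      using t by (simp flip: ennreal_mult ennreal_plus)
  qed
  with K show ?thesis by blast
qed

text \<open>Strict concavity of the logarithm at the midpoint, from \<open>((a + b) / 2)\<^sup>2 - a b = ((a - b) / 2)\<^sup>2\<close>.\<close>

lemma ln_midpoint:
  fixes a b :: real
  assumes "0 < a" "0 < b"
  shows "(ln a + ln b) / 2 \<le> ln ((a + b) / 2)"
    and "(ln a + ln b) / 2 = ln ((a + b) / 2) \<Longrightarrow> a = b"
proof -
  have sq: "((a + b) / 2)\<^sup>2 - a * b = ((a - b) / 2)\<^sup>2"
    by (simp add: power2_eq_square field_simps)
  have l: "ln (a * b) = ln a + ln b" "ln (((a + b) / 2)\<^sup>2) = 2 * ln ((a + b) / 2)"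
    using assms by (simp_all add: ln_mult_pos ln_realpow)
  have "a * b \<le> ((a + b) / 2)\<^sup>2"
    using sq zero_le_power2[of "(a - b) / 2"] by linarith
  then have "ln (a * b) \<le> ln (((a + b) / 2)\<^sup>2)"
    using assms by (intro ln_mono) auto
  then show "(ln a + ln b) / 2 \<le> ln ((a + b) / 2)" using l by simp
  assume "(ln a + ln b) / 2 = ln ((a + b) / 2)"
  then have "ln (a * b) = ln (((a + b) / 2)\<^sup>2)" using l by simp
  then have "a * b = ((a + b) / 2)\<^sup>2" using assms by (subst (asm) ln_inj_iff) auto
  then show "a = b" using sq by simp
qed

text \<open>Since \<open>(sqrt u - 1)\<^sup>2 = u + 1 - 2 sqrt u\<close> and \<open>E u \<le> 1\<close>, half the expected square is at most
\<open>1 - E (sqrt u)\<close>.  In the well-specified case \<open>E u = 1\<close> and this is the usual identity between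
squared Hellinger distance and affinity; under misspecification only the inequality survives, in the
direction that is required.\<close>

lemma (in prob_space) expectation_sqrt_le:
  assumes u [measurable]: "u \<in> borel_measurable M" and u0: "\<And>x. 0 \<le> u x"
    and u1: "(\<integral>\<^sup>+x. ennreal (u x) \<partial>M) \<le> 1"
    and h: "ennreal \<delta> \<le> 1 / 2 * (\<integral>\<^sup>+x. ennreal ((sqrt (u x) - 1)\<^sup>2) \<partial>M)"
  shows "integrable M (\<lambda>x. sqrt (u x))" and "expectation (\<lambda>x. sqrt (u x)) \<le> 1 - \<delta>"
proof -
  have intu: "integrable M u"
    using u1 u0 by (intro integrableI_nonneg) (auto intro: le_less_trans)
  then have "ennreal (expectation u) \<le> ennreal 1"
    using u1 u0 by (subst nn_integral_eq_integral[symmetric]) auto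
  then have Eu: "expectation u \<le> 1" by (subst (asm) ennreal_le_iff) auto
  show ints: "integrable M (\<lambda>x. sqrt (u x))"
  proof (rule Bochner_Integration.integrable_bound[of _ "\<lambda>x. 1 + u x"])
    have "sqrt y \<le> 1 + y" if "0 \<le> y" for y :: real
      using that by (intro real_le_lsqrt) (auto simp: power2_eq_square algebra_simps)
    then show "AE x in M. norm (sqrt (u x)) \<le> norm (1 + u x)" using u0 by simp
  qed (use intu in auto)
  have sq: "(sqrt (u x) - 1)\<^sup>2 = u x + 1 - 2 * sqrt (u x)" for x
    using u0[of x] by (simp add: power2_diff)
  have "(\<integral>\<^sup>+x. ennreal ((sqrt (u x) - 1)\<^sup>2) \<partial>M) = ennreal (expectation (\<lambda>x. (sqrt (u x) - 1)\<^sup>2))"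
  proof (intro nn_integral_eq_integral)
    show "integrable M (\<lambda>x. (sqrt (u x) - 1)\<^sup>2)"
      unfolding sq using intu ints by (intro Bochner_Integration.integrable_diff
        Bochner_Integration.integrable_add integrable_mult_right integrable_const)
  qed simp
  also have "expectation (\<lambda>x. (sqrt (u x) - 1)\<^sup>2) = expectation u + 1 - 2 * expectation (\<lambda>x. sqrt (u x))"
    using intu ints by (simp add: sq prob_space)
  finally have int_sq: "(\<integral>\<^sup>+x. ennreal ((sqrt (u x) - 1)\<^sup>2) \<partial>M)
      = ennreal (expectation u + 1 - 2 * expectation (\<lambda>x. sqrt (u x)))" (is "_ = ennreal ?r") .
  have "expectation (\<lambda>x. (sqrt (u x) - 1)\<^sup>2) = ?r"
    using intu ints by (simp add: sq prob_space)
  then have r: "0 \<le> ?r"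
    by (metis (mono_tags, lifting) Bochner_Integration.integral_nonneg zero_le_power2)
  have "(1 / 2 :: ennreal) = ennreal (1 / 2)"
    using divide_ennreal[of 1 2] by simp
  then have "ennreal \<delta> \<le> ennreal (1 / 2 * ?r)"
    using h r unfolding int_sq by (subst ennreal_mult) auto
  then have "\<delta> \<le> 1 / 2 * ?r" using r by (subst (asm) ennreal_le_iff) auto
  then show "expectation (\<lambda>x. sqrt (u x)) \<le> 1 - \<delta>"
    using Eu by (simp add: field_simps)
qed

text \<open>Fitting mixtures to an arbitrary law \<open>P\<close>.  The second moment makes all log scores finite.  The last
assumption says that Lebesgue measure is absolutely continuous with respect to \<open>P\<close>; it allows mixtures
that agree \<open>P\<close>-almost everywhere to be identified.\<close>

locale mixture_fit = real_distribution P for P :: "real measure" +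
  fixes \<sigma> L :: real
  assumes \<sigma>_pos: "\<sigma> > 0" and L_pos: "L > 0"
    and integrable_sq: "integrable P (\<lambda>x. x\<^sup>2)"
    and AE_lborel: "\<And>Q. AE x in P. Q x \<Longrightarrow> AE x in lborel. Q x"
begin

abbreviation mixing :: "real measure set" where
  "mixing \<equiv> borel_probs {-L..L}"

abbreviation mix :: "real measure \<Rightarrow> real \<Rightarrow> real" where
  "mix \<equiv> gauss_mixture \<sigma>"

text \<open>Up to sign and an additive constant that depends on \<open>P\<close> only, this is the Kullback-Leibler divergence
from the true density to the mixture.\<close>

definition log_score :: "real measure \<Rightarrow> real" where
  "log_score H = (\<integral>x. ln (mix H x) \<partial>P)"

lemma mixingD:
  assumes "H \<in> mixing"
  shows "real_distribution H" "AE \<xi> in H. \<xi> \<in> {-L..L}" "0 < mix H x"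
    and mix_measurable: "mix H \<in> borel_measurable borel"
proof -
  show H: "real_distribution H" "AE \<xi> in H. \<xi> \<in> {-L..L}" using assms by (auto simp: borel_probs_iff)
  interpret H: real_distribution H by (rule H)
  show "0 < mix H x" by (rule H.gauss_mixture_pos[OF \<sigma>_pos])
  show "mix H \<in> borel_measurable borel" by (rule H.gauss_mixture_measurable)
qed

lemma mix_measurable_P: "H \<in> mixing \<Longrightarrow> mix H \<in> borel_measurable P"
  using mix_measurable by (simp add: measurable_def)

definition ln_bound :: "real \<Rightarrow> real" where
  "ln_bound x = 1 + \<bar>ln (1 / sqrt (2 * pi * \<sigma>\<^sup>2))\<bar> + (x\<^sup>2 + L\<^sup>2) / \<sigma>\<^sup>2"

lemma abs_ln_mix_le: "H \<in> mixing \<Longrightarrow> \<bar>ln (mix H x)\<bar> \<le> ln_bound x"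
  unfolding ln_bound_def
  by (rule real_distribution.abs_ln_gauss_mixture_le[OF mixingD(1) \<sigma>_pos])
     (auto simp: borel_probs_def measure_def)

lemma integrable_ln_bound: "integrable P ln_bound"
proof -
  have "integrable P (\<lambda>x. 1 + \<bar>ln (1 / sqrt (2 * pi * \<sigma>\<^sup>2))\<bar> + (x\<^sup>2 + L\<^sup>2) / \<sigma>\<^sup>2)"
    by (intro Bochner_Integration.integrable_add integrable_divide integrable_sq integrable_const)
  then show ?thesis by (simp add: ln_bound_def[abs_def])
qed

lemma integrable_ln_mix: "H \<in> mixing \<Longrightarrow> integrable P (\<lambda>x. ln (mix H x))"
  using abs_ln_mix_le mix_measurable_P
  by (intro Bochner_Integration.integrable_bound[OF integrable_ln_bound]) (auto intro: order_trans[OF _ abs_ge_self])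

lemma mixing_nonempty: "mixing \<noteq> {}"
proof -
  have "return borel 0 \<in> mixing"
    using L_pos by (auto simp: borel_probs_def intro: prob_space_return)
  then show ?thesis by blast
qed

text \<open>Weak sequential compactness by Helly's theorem.  The limit still lives on \<open>[-L, L]\<close> because the
continuous function that measures the (truncated) distance to this interval keeps integral zero, and
mixture densities converge pointwise because the kernel is a bounded continuous function of its mean.\<close>

lemma mixing_convergent_subsequence:
  fixes H :: "nat \<Rightarrow> real measure"
  assumes H: "\<And>n. H n \<in> mixing"
  shows "\<exists>r K. strict_mono r \<and> K \<in> mixing \<and> (\<forall>x. (\<lambda>n. mix (H (r n)) x) \<longlonglongrightarrow> mix K x)"
proof -
  have "tight H"
    unfolding tight_def
  proof (intro conjI allI impI)
    fix n show "real_distribution (H n)" using mixingD(1)[OF H] .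
  next
    fix \<epsilon> :: real assume \<epsilon>: "\<epsilon> > 0"
    \<comment> \<open>tightness is stated with left-open intervals, so the point \<open>-L\<close> needs a margin\<close>
    have "measure (H n) {-L-1<..L} = 1" for n
    proof -
      interpret Hn: real_distribution "H n" using mixingD(1)[OF H] .
      show ?thesis using mixingD(2)[OF H, of n] by (subst Hn.prob_eq_1) (auto elim!: eventually_mono)
    qed
    then show "\<exists>a b. a < b \<and> (\<forall>n. 1 - \<epsilon> < measure (H n) {a<..b})"
      using \<epsilon> L_pos by (intro exI[of _ "-L-1"] exI[of _ L]) auto
  qed
  from tight_imp_convergent_subsubsequence[OF this strict_mono_id]
  obtain r K where r: "strict_mono r" and K: "real_distribution K" and w: "weak_conv_m (H \<circ> id \<circ> r) K"
    by auto
  interpret K: real_distribution K by fact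
  have conv: "(\<lambda>n. \<integral>\<xi>. f \<xi> \<partial>H (r n)) \<longlonglongrightarrow> (\<integral>\<xi>. f \<xi> \<partial>K)"
    if "\<And>x. isCont f x" "\<And>x. norm (f x) \<le> b" for f :: "real \<Rightarrow> real" and b
    using weak_conv_imp_integral_bdd_continuous_conv[OF _ K w that] mixingD(1)[OF H] by (simp add: comp_def)
  \<comment> \<open>vanishes exactly on \<open>[-L, L]\<close>\<close>
  define g where "g \<xi> = min 1 (max 0 (\<bar>\<xi>\<bar> - L))" for \<xi>
  have gc: "isCont g \<xi>" for \<xi>
    unfolding g_def[abs_def] by (intro continuous_intros)
  have [measurable]: "g \<in> borel_measurable borel"
    using gc by (intro borel_measurable_continuous_onI) (simp add: continuous_at_imp_continuous_on)
  have "(\<integral>\<xi>. g \<xi> \<partial>H (r n)) = 0" for n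
    by (intro integral_eq_zero_AE eventually_mono[OF mixingD(2)[OF H]]) (auto simp: g_def)
  moreover have "(\<lambda>n. \<integral>\<xi>. g \<xi> \<partial>H (r n)) \<longlonglongrightarrow> (\<integral>\<xi>. g \<xi> \<partial>K)"
  proof (rule conv[OF gc])
    show "norm (g \<xi>) \<le> 1" for \<xi> by (simp add: g_def)
  qed
  ultimately have "(\<integral>\<xi>. g \<xi> \<partial>K) = 0" by (simp add: LIMSEQ_const_iff)
  moreover have "integrable K g" by (rule K.integrable_const_bound[where B = 1]) (auto simp: g_def)
  ultimately have "AE \<xi> in K. g \<xi> = 0"
    by (subst (asm) integral_nonneg_eq_0_iff_AE) (auto simp: g_def)
  then have "AE \<xi> in K. \<xi> \<in> {-L..L}"
    by eventually_elim (auto simp: g_def min_def max_def split: if_splits)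
  with K have "K \<in> mixing" by (simp add: borel_probs_iff)
  moreover have "(\<lambda>n. mix (H (r n)) x) \<longlonglongrightarrow> mix K x" for x
    unfolding gauss_mixture_def
  proof (rule conv)
    show "isCont (\<lambda>\<xi>. normal_density 0 \<sigma> (x - \<xi>)) y" for y
      unfolding normal_density_def using \<sigma>_pos by (intro continuous_intros) auto
    show "norm (normal_density 0 \<sigma> (x - y)) \<le> 1 / sqrt (2 * pi * \<sigma>\<^sup>2)" for y
      using normal_density_le by simp
  qed
  ultimately show ?thesis using r by blast
qed

text \<open>The direct method: a maximising sequence has a convergent subsequence, and the quadratic bound on the
log densities lets the score pass to the limit.\<close>

lemma log_score_maximizer_exists: "\<exists>H\<in>mixing. \<forall>H'\<in>mixing. log_score H' \<le> log_score H"
proof -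
  define S where "S = log_score ` mixing"
  have S: "S \<noteq> {}" using mixing_nonempty by (simp add: S_def)
  have bdd: "bdd_above S"
  proof (rule bdd_aboveI)
    fix s assume "s \<in> S"
    then obtain H where H: "H \<in> mixing" "s = log_score H" by (auto simp: S_def)
    have "ln (mix H x) \<le> ln_bound x" for x using abs_ln_mix_le[OF H(1), of x] by linarith
    then show "s \<le> (\<integral>x. ln_bound x \<partial>P)"
      unfolding H(2) log_score_def
      by (intro integral_mono integrable_ln_mix[OF H(1)] integrable_ln_bound)
  qed
  have "Sup S \<in> closure S" using closure_contains_Sup[OF S bdd] .
  then obtain s where s: "\<And>n. s n \<in> S" "s \<longlonglongrightarrow> Sup S" by (auto simp: closure_sequential)
  from s(1) have "\<forall>n. \<exists>H. H \<in> mixing \<and> s n = log_score H" by (auto simp: S_def)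
  then obtain H where H: "\<And>n. H n \<in> mixing" "\<And>n. s n = log_score (H n)" by metis
  obtain r K where r: "strict_mono r" and K: "K \<in> mixing"
    and conv: "\<And>x. (\<lambda>n. mix (H (r n)) x) \<longlonglongrightarrow> mix K x"
    using mixing_convergent_subsequence[of H] H(1) by blast
  have "(\<lambda>n. log_score (H (r n))) \<longlonglongrightarrow> log_score K"
    unfolding log_score_def
  proof (rule integral_dominated_convergence[where w = ln_bound])
    show "AE x in P. (\<lambda>n. ln (mix (H (r n)) x)) \<longlonglongrightarrow> ln (mix K x)"
      using conv mixingD(3)[OF K] by (intro AE_I2 tendsto_ln) (simp_all add: less_imp_neq[symmetric])
    show "(\<lambda>x. ln (mix K x)) \<in> borel_measurable P"
      using integrable_ln_mix[OF K] by (rule borel_measurable_integrable)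
    show "(\<lambda>x. ln (mix (H (r n)) x)) \<in> borel_measurable P" for n
      using integrable_ln_mix[OF H(1)] by (rule borel_measurable_integrable)
    show "AE x in P. norm (ln (mix (H (r n)) x)) \<le> ln_bound x" for n
      using abs_ln_mix_le[OF H(1)] by (intro AE_I2) simp
  qed (rule integrable_ln_bound)
  moreover have "(\<lambda>n. log_score (H (r n))) \<longlonglongrightarrow> Sup S"
    using LIMSEQ_subseq_LIMSEQ[OF s(2) r] by (simp add: comp_def H(2))
  ultimately have "log_score K = Sup S" by (rule LIMSEQ_unique)
  then have "\<forall>H'\<in>mixing. log_score H' \<le> log_score K"
    using cSup_upper[OF _ bdd] by (auto simp: S_def)
  with K show ?thesis by blast
qed

text \<open>The midpoint of two maximisers would score strictly better unless their densities agree almost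
everywhere, and equal mixtures have equal mixing distributions.\<close>

lemma log_score_maximizer_unique:
  assumes H: "H \<in> mixing" "\<And>K. K \<in> mixing \<Longrightarrow> log_score K \<le> log_score H"
    and H': "H' \<in> mixing" "\<And>K. K \<in> mixing \<Longrightarrow> log_score K \<le> log_score H'"
  shows "H = H'"
proof -
  obtain K where K: "K \<in> mixing" and eq: "\<And>x. mix K x = (mix H x + mix H' x) / 2"
    using borel_probs_convex[OF _ H(1) H'(1), of "1/2"] by (auto simp: field_simps)
  define d where "d x = ln (mix K x) - (ln (mix H x) + ln (mix H' x)) / 2" for x
  have d0: "0 \<le> d x" for x
    using ln_midpoint(1)[OF mixingD(3)[OF H(1)] mixingD(3)[OF H'(1)], of x x] by (simp add: d_def eq)
  have int: "integrable P d"
    unfolding d_def[abs_def] using H(1) H'(1) K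
    by (intro Bochner_Integration.integrable_diff integrable_divide Bochner_Integration.integrable_add integrable_ln_mix)
  have "(\<integral>x. d x \<partial>P) = log_score K - (log_score H + log_score H') / 2"
    unfolding d_def[abs_def] log_score_def using integrable_ln_mix[OF H(1)] integrable_ln_mix[OF H'(1)] integrable_ln_mix[OF K]
    by simp
  also have "\<dots> \<le> 0" using H(2)[OF K] H'(2)[OF K] by simp
  finally have "(\<integral>x. d x \<partial>P) = 0" using d0 by (intro antisym Bochner_Integration.integral_nonneg) auto
  then have "AE x in P. d x = 0" using int d0 by (subst (asm) integral_nonneg_eq_0_iff_AE) auto
  then have "AE x in lborel. d x = 0" by (rule AE_lborel)
  then have "AE x in lborel. mix H x = mix H' x"
  proof eventually_elim
    case (elim x)
    then show ?case
      using ln_midpoint(2)[OF mixingD(3)[OF H(1)] mixingD(3)[OF H'(1)], of x x] by (simp add: d_def eq)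
  qed
  then show ?thesis by (rule gauss_mixture_inj[OF \<sigma>_pos mixingD(1)[OF H(1)] mixingD(1)[OF H'(1)]])
qed

text \<open>First-order condition at the maximiser \<open>H\<close>.  Moving a fraction \<open>t\<close> of the mass to \<open>H'\<close> does not raise
the score, so the difference quotient \<open>log (1 + t (u - 1)) / t\<close> of the log densities, with
\<open>u = f\<^sub>H\<^sub>' / f\<^sub>H\<close>, has integral at most \<open>0\<close>.  It tends to \<open>u - 1\<close> as \<open>t\<close> decreases to \<open>0\<close>.  The ratio
\<open>u\<close> may grow exponentially, so it is not known beforehand to be integrable under \<open>P\<close>; but the quotients are
bounded below by \<open>-2\<close> for \<open>t \<le> 1/2\<close>, and Fatou's lemma applies.\<close>

lemma likelihood_ratio_integral_le_1:
  assumes H: "H \<in> mixing" "\<And>K. K \<in> mixing \<Longrightarrow> log_score K \<le> log_score H"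
    and H': "H' \<in> mixing"
  shows "(\<integral>\<^sup>+x. ennreal (mix H' x / mix H x) \<partial>P) \<le> 1"
proof -
  define u where "u x = mix H' x / mix H x" for x
  note [measurable] = mix_measurable[OF H(1)] mix_measurable[OF H']
  have u: "0 < u x" for x using mixingD(3)[OF H(1)] mixingD(3)[OF H'] by (simp add: u_def)
  \<comment> \<open>any sequence in \<open>(0, 1/2]\<close> that tends to \<open>0\<close> would do\<close>
  define t where "t k = 1 / real (k + 2)" for k
  have t: "0 < t k" "t k \<le> 1 / 2" for k by (auto simp: t_def field_simps)
  have "\<exists>K\<in>mixing. \<forall>x. mix K x = (1 - t k) * mix H x + t k * mix H' x" for k
    using borel_probs_convex[OF _ H(1) H', of "t k"] t[of k] by fastforce
  then obtain K where K: "\<And>k. K k \<in> mixing" "\<And>k x. mix (K k) x = (1 - t k) * mix H x + t k * mix H' x"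
    by metis
  define D where "D k x = (ln (mix (K k) x) - ln (mix H x)) / t k" for k x
  have D_eq: "D k x = ln (1 + t k * (u x - 1)) / t k" for k x
  proof -
    have "mix (K k) x / mix H x = 1 + t k * (u x - 1)"
      using mixingD(3)[OF H(1), of x] by (simp add: K(2) u_def field_simps)
    then show ?thesis
      using mixingD(3)[OF H(1), of x] mixingD(3)[OF K(1), of k x] ln_div[of "mix (K k) x" "mix H x"]
      by (simp add: D_def)
  qed
  have D_ge: "0 \<le> D k x + 2" for k x
  proof -
    have "- 2 * t k \<le> ln (1 - t k)"
    proof -
      have "ln (1 / (1 - t k)) \<le> 1 / (1 - t k) - 1" using t[of k] by (intro ln_le_minus_one) auto
      also have "\<dots> = t k / (1 - t k)" using t[of k] by (simp add: field_simps)
      also have "\<dots> \<le> t k / (1 / 2)" using t[of k] by (intro divide_left_mono) auto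
      finally show ?thesis using t[of k] by (simp add: ln_div)
    qed
    also have "\<dots> \<le> ln (1 + t k * (u x - 1))"
      using t[of k] u[of x] by (intro ln_mono) (auto simp: algebra_simps)
    finally show ?thesis using t[of k] by (simp add: D_eq field_simps)
  qed
  have D_int: "integrable P (D k)" for k
    unfolding D_def[abs_def]
    by (intro integrable_divide Bochner_Integration.integrable_diff integrable_ln_mix K H(1))
  have "(\<integral>x. D k x \<partial>P) = (log_score (K k) - log_score H) / t k" for k
    unfolding D_def[abs_def] log_score_def using integrable_ln_mix[OF K(1)] integrable_ln_mix[OF H(1)] by simp
  then have D_le: "(\<integral>x. D k x \<partial>P) \<le> 0" for k
    using H(2)[OF K(1), of k] t(1)[of k] by (simp add: divide_nonpos_pos)
  have nn: "(\<integral>\<^sup>+x. ennreal (D k x + 2) \<partial>P) \<le> 2" for k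
  proof -
    have "(\<integral>\<^sup>+x. ennreal (D k x + 2) \<partial>P) = ennreal (\<integral>x. D k x + 2 \<partial>P)"
      using D_int D_ge by (intro nn_integral_eq_integral) auto
    also have "(\<integral>x. D k x + 2 \<partial>P) = (\<integral>x. D k x \<partial>P) + 2"
      using D_int by (simp add: prob_space del: space_eq_univ)
    also have "ennreal \<dots> \<le> ennreal 2" using D_le[of k] by (intro ennreal_leI) simp
    finally show ?thesis by simp
  qed
  have lim: "(\<lambda>k. ennreal (D k x + 2)) \<longlonglongrightarrow> ennreal (u x + 1)" for x
  proof -
    have "((\<lambda>s. ln (1 + s * (u x - 1))) has_field_derivative (u x - 1)) (at 0)"
      by (auto intro!: derivative_eq_intros)
    then have "((\<lambda>s. ln (1 + s * (u x - 1)) / s) \<longlongrightarrow> u x - 1) (at 0)"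
      by (simp add: DERIV_def)
    moreover have "filterlim t (at 0) sequentially"
      unfolding filterlim_at
    proof
      show "\<forall>\<^sub>F k in sequentially. t k \<in> UNIV \<and> t k \<noteq> 0" using t(1) by (simp add: less_imp_neq[symmetric])
      show "t \<longlonglongrightarrow> 0"
        using LIMSEQ_ignore_initial_segment[OF lim_inverse_n', of 2] by (simp add: t_def[abs_def])
    qed
    ultimately have "(\<lambda>k. D k x) \<longlonglongrightarrow> u x - 1"
      unfolding D_eq by (rule filterlim_compose)
    then have "(\<lambda>k. D k x + 2) \<longlonglongrightarrow> u x - 1 + 2" by (intro tendsto_intros)
    also have "u x - 1 + 2 = u x + 1" by simp
    finally show ?thesis by (intro tendsto_ennrealI)
  qed
  have "(\<integral>\<^sup>+x. ennreal (u x + 1) \<partial>P) = (\<integral>\<^sup>+x. liminf (\<lambda>k. ennreal (D k x + 2)) \<partial>P)"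
    using lim by (intro nn_integral_cong lim_imp_Liminf[symmetric]) auto
  also have "\<dots> \<le> liminf (\<lambda>k. \<integral>\<^sup>+x. ennreal (D k x + 2) \<partial>P)"
    using D_int by (intro nn_integral_liminf) auto
  also have "\<dots> \<le> 2"
    using nn by (intro Liminf_le) auto
  finally have "(\<integral>\<^sup>+x. ennreal (u x) + 1 \<partial>P) \<le> 2"
    using u by (simp add: less_imp_le flip: ennreal_plus ennreal_1)
  moreover have "(\<integral>\<^sup>+x. ennreal (u x) + 1 \<partial>P) = (\<integral>\<^sup>+x. ennreal (u x) \<partial>P) + 1"
    using emeasure_space_1 by (subst nn_integral_add) (auto simp: u_def[abs_def])
  ultimately have "1 + (\<integral>\<^sup>+x. ennreal (u x) \<partial>P) \<le> 1 + 1" by (simp add: add.commute)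
  then show ?thesis unfolding u_def by (subst (asm) ennreal_add_left_cancel_le) simp
qed

end

section \<open>The true law: marginals of the sample and moments\<close>

text \<open>Integrating the conditional law of the observations gives the joint probability of a rectangle as the
expectation of a product of functions of the \<open>\<theta>\<^sub>i\<close>.  Independence of the \<open>\<theta>\<^sub>i\<close> splits it
into the mixture probabilities of the sides.  Rectangles with a single nontrivial side give the marginals,
and the product formula is then independence.\<close>

lemma normal_means_model_iid:
  assumes model: "normal_means_model M n G \<theta> X" and G: "G \<in> borel_probs UNIV" and n: "n \<ge> 1"
  shows "prob_space.indep_vars M (\<lambda>_. borel) X {1..n}"
    and "\<And>i. i \<in> {1..n} \<Longrightarrow> distributed M lborel (X i) (true_density G)"
proof -
  interpret G: real_distribution G using G by (simp add: borel_probs_iff)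
  interpret prob_space M using model by (simp add: normal_means_model_def)
  let ?I = "{1..n}"
  have \<theta> [measurable]: "\<And>i. i \<in> ?I \<Longrightarrow> \<theta> i \<in> borel_measurable M"
    and X [measurable]: "\<And>i. i \<in> ?I \<Longrightarrow> X i \<in> borel_measurable M"
    and ind: "indep_vars (\<lambda>_. borel) \<theta> ?I" and dist: "\<And>i. i \<in> ?I \<Longrightarrow> distr M borel (\<theta> i) = G"
    using model by (auto simp: normal_means_model_def)
  define \<Theta> where "\<Theta> = (\<lambda>\<omega>. \<lambda>i\<in>?I. \<theta> i \<omega>)"
  define F where "F = vimage_algebra (space M) \<Theta> (\<Pi>\<^sub>M i\<in>?I. (borel :: real measure))"
  have \<Theta>: "\<Theta> \<in> measurable M (\<Pi>\<^sub>M i\<in>?I. borel)"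
    unfolding \<Theta>_def by (rule measurable_restrict) (rule \<theta>)
  have "subalgebra M F"
    unfolding subalgebra_def F_def
    using measurable_sets[OF \<Theta>] measurable_space[OF \<Theta>] by (auto simp: sets_vimage_algebra2)
  then interpret F: finite_measure_subalgebra M F by unfold_locales
  define \<mu> where "\<mu> = density lborel (true_density G)"
  interpret \<mu>: real_distribution \<mu>
    unfolding \<mu>_def by (rule G.real_distribution_gauss_mixture) simp
  define \<kappa> where "\<kappa> A t = measure (density lborel (normal_density t 1)) A" for A t
  have \<kappa>_prob: "prob_space (density lborel (normal_density t 1))" for t
    by (rule prob_space_normal_density) simp
  have \<kappa>01: "0 \<le> \<kappa> A t" "\<kappa> A t \<le> 1" for A t
    using prob_space.prob_le_1[OF \<kappa>_prob] by (auto simp: \<kappa>_def)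
  have \<kappa>_meas: "\<kappa> A \<in> borel_measurable borel" if [measurable]: "A \<in> sets borel" for A
  proof -
    have "\<kappa> A t = enn2real (\<integral>\<^sup>+x. ennreal (normal_density 0 1 (x - t)) * indicator A x \<partial>lborel)" for t
      by (simp add: \<kappa>_def measure_def emeasure_density normal_density_shift)
    then show ?thesis by (subst measurable_cong) auto
  qed
  have \<kappa>_int: "(\<integral>t. \<kappa> A t \<partial>G) = measure \<mu> A" if A [measurable]: "A \<in> sets borel" for A
  proof -
    have "ennreal (measure \<mu> A) = (\<integral>\<^sup>+t. emeasure (density lborel (normal_density t 1)) A \<partial>G)"
      unfolding \<mu>.emeasure_eq_measure[symmetric] unfolding \<mu>_def
      by (rule G.emeasure_gauss_mixture[OF _ A]) simp
    also have "\<dots> = (\<integral>\<^sup>+t. ennreal (\<kappa> A t) \<partial>G)"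
      by (intro nn_integral_cong)
         (simp add: \<kappa>_def finite_measure.emeasure_eq_measure[OF prob_space.finite_measure[OF \<kappa>_prob]])
    also have "\<dots> = ennreal (\<integral>t. \<kappa> A t \<partial>G)"
      using \<kappa>01 \<kappa>_meas[OF A] by (intro nn_integral_eq_integral G.integrable_const_bound[where B = 1]) auto
    finally show ?thesis using \<kappa>01 by (subst (asm) ennreal_inj) (auto intro!: Bochner_Integration.integral_nonneg)
  qed
  have joint: "prob {\<omega> \<in> space M. \<forall>i\<in>?I. X i \<omega> \<in> A i} = (\<Prod>i\<in>?I. measure \<mu> (A i))"
    if A: "\<And>i. i \<in> ?I \<Longrightarrow> A i \<in> sets borel" for A
  proof -
    let ?E = "{\<omega> \<in> space M. \<forall>i\<in>?I. X i \<omega> \<in> A i}"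
    have E: "?E \<in> events"
      using A by (intro sets.sets_Collect_finite_All measurable_sets_Collect[OF X]) auto
    have "prob ?E = (\<integral>\<omega>. indicator ?E \<omega> \<partial>M)" using E by simp
    also have "\<dots> = (\<integral>\<omega>. real_cond_exp M F (indicator ?E) \<omega> \<partial>M)"
      using E by (intro F.real_cond_exp_int(2)[symmetric]) (auto simp: less_top[symmetric])
    also have "\<dots> = (\<integral>\<omega>. (\<Prod>i\<in>?I. \<kappa> (A i) (\<theta> i \<omega>)) \<partial>M)"
    proof (rule integral_cong_AE)
      show "AE \<omega> in M. real_cond_exp M F (indicator ?E) \<omega> = (\<Prod>i\<in>?I. \<kappa> (A i) (\<theta> i \<omega>))"
        using model A unfolding normal_means_model_def F_def \<Theta>_def \<kappa>_def by blast
      show "(\<lambda>\<omega>. \<Prod>i\<in>?I. \<kappa> (A i) (\<theta> i \<omega>)) \<in> borel_measurable M"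
        by (intro borel_measurable_prod measurable_compose[OF \<theta> \<kappa>_meas] A)
    qed simp
    also have "\<dots> = (\<Prod>i\<in>?I. \<integral>\<omega>. \<kappa> (A i) (\<theta> i \<omega>) \<partial>M)"
    proof (rule indep_vars_lebesgue_integral)
      show "indep_vars (\<lambda>_. borel) (\<lambda>i \<omega>. \<kappa> (A i) (\<theta> i \<omega>)) ?I"
        by (rule indep_vars_compose2[OF ind \<kappa>_meas]) (rule A)
      show "integrable M (\<lambda>\<omega>. \<kappa> (A i) (\<theta> i \<omega>))" if "i \<in> ?I" for i
        using \<kappa>01 by (intro integrable_const_bound[where B = 1] measurable_compose[OF \<theta> \<kappa>_meas] that A) auto
    qed simp
    also have "\<dots> = (\<Prod>i\<in>?I. measure \<mu> (A i))"
    proof (rule prod.cong[OF refl])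
      fix i assume i: "i \<in> ?I"
      have "(\<integral>\<omega>. \<kappa> (A i) (\<theta> i \<omega>) \<partial>M) = (\<integral>t. \<kappa> (A i) t \<partial>distr M borel (\<theta> i))"
        by (rule integral_distr[symmetric, OF \<theta>[OF i] \<kappa>_meas[OF A[OF i]]])
      then show "(\<integral>\<omega>. \<kappa> (A i) (\<theta> i \<omega>) \<partial>M) = measure \<mu> (A i)"
        using \<kappa>_int[OF A[OF i]] dist[OF i] by simp
    qed
    finally show ?thesis .
  qed
  have marg: "prob (X i -` B \<inter> space M) = measure \<mu> B" if i: "i \<in> ?I" and B: "B \<in> sets borel" for i B
  proof -
    have "{\<omega> \<in> space M. \<forall>j\<in>?I. X j \<omega> \<in> (if j = i then B else UNIV)} = X i -` B \<inter> space M"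
      using i by (auto split: if_splits)
    then have "prob (X i -` B \<inter> space M) = (\<Prod>j\<in>?I. measure \<mu> (if j = i then B else UNIV))"
      using joint[of "\<lambda>j. if j = i then B else UNIV"] B by (simp split: if_splits)
    also have "\<dots> = (\<Prod>j\<in>?I. if j = i then measure \<mu> B else 1)"
      using \<mu>.prob_space by (intro prod.cong) auto
    also have "\<dots> = measure \<mu> B" using i by (simp add: prod.delta)
    finally show ?thesis .
  qed
  show "distributed M lborel (X i) (true_density G)" if i: "i \<in> ?I" for i
    unfolding distributed_def
  proof (intro conjI)
    have "distr M lborel (X i) = \<mu>"
    proof (rule measure_eqI)
      fix B assume "B \<in> sets (distr M lborel (X i))"
      then have B: "B \<in> sets borel" by simp
      then show "emeasure (distr M lborel (X i)) B = emeasure \<mu> B"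
        using marg[OF i B] X[OF i]
        by (simp add: emeasure_distr emeasure_eq_measure \<mu>.emeasure_eq_measure)
    qed simp
    then show "distr M lborel (X i) = density lborel (true_density G)" by (simp add: \<mu>_def)
  qed (use X[OF i] in auto)
  show "indep_vars (\<lambda>_. borel) X ?I"
    unfolding indep_vars_def2
  proof (intro conjI ballI)
    show "indep_sets (\<lambda>i. {X i -` A \<inter> space M |A. A \<in> sets borel}) ?I"
    proof (subst indep_sets_finite)
      show "?I \<noteq> {}" using n by auto
      show "{X i -` A \<inter> space M |A. A \<in> sets borel} \<subseteq> events" if "i \<in> ?I" for i
        using X[OF that] by (auto intro: measurable_sets)
      show "space M \<in> {X i -` A \<inter> space M |A. A \<in> sets borel}" for i
        by (auto intro!: exI[of _ UNIV])
      show "\<forall>C\<in>Pi ?I (\<lambda>i. {X i -` A \<inter> space M |A. A \<in> sets borel}).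
          prob (\<Inter>j\<in>?I. C j) = (\<Prod>j\<in>?I. prob (C j))"
      proof
        fix C assume C: "C \<in> Pi ?I (\<lambda>i. {X i -` A \<inter> space M |A. A \<in> sets borel})"
        have "\<exists>A. A \<in> sets borel \<and> C i = X i -` A \<inter> space M" if "i \<in> ?I" for i
          using Pi_mem[OF C that] by blast
        then obtain A where A: "\<And>i. i \<in> ?I \<Longrightarrow> A i \<in> sets borel"
          "\<And>i. i \<in> ?I \<Longrightarrow> C i = X i -` A i \<inter> space M" by metis
        have "(\<Inter>j\<in>?I. C j) = (\<Inter>j\<in>?I. X j -` A j \<inter> space M)"
          using A(2) by (intro INF_cong) auto
        also have "\<dots> = {\<omega> \<in> space M. \<forall>i\<in>?I. X i \<omega> \<in> A i}"
          using n by auto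
        finally have "(\<Inter>j\<in>?I. C j) = {\<omega> \<in> space M. \<forall>i\<in>?I. X i \<omega> \<in> A i}" .
        moreover have "(\<Prod>j\<in>?I. prob (C j)) = (\<Prod>j\<in>?I. measure \<mu> (A j))"
          using A marg by (intro prod.cong) auto
        ultimately show "prob (\<Inter>j\<in>?I. C j) = (\<Prod>j\<in>?I. prob (C j))"
          using joint[OF A(1)] by simp
      qed
    qed simp
  qed (rule X)
qed

context real_distribution
begin

text \<open>Provides the radius at which the quadratic bound on \<open>\<bar>ln\<bar>\<close> of a mixture density can be applied to a
mixing distribution of unbounded support.\<close>

lemma half_mass_interval: "\<exists>R. 1 / 2 \<le> prob {-R..R}"
proof -
  let ?A = "\<lambda>n. {- real n..real n}"
  have "(\<lambda>n. prob (?A n)) \<longlonglongrightarrow> prob (\<Union>n. ?A n)"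
    by (rule finite_Lim_measure_incseq) (auto simp: incseq_def)
  moreover have "(\<Union>n. ?A n) = UNIV"
  proof -
    have "\<exists>n. x \<in> ?A n" for x
    proof -
      obtain n where "\<bar>x\<bar> \<le> real n" using real_arch_simple by blast
      then have "x \<in> ?A n" by auto
      then show ?thesis ..
    qed
    then show ?thesis by auto
  qed
  ultimately have "(\<lambda>n. prob (?A n)) \<longlonglongrightarrow> 1" using prob_space by simp
  then have "\<forall>\<^sub>F n in sequentially. 1 / 2 < prob (?A n)" by (rule order_tendstoD) simp
  then obtain n where "1 / 2 < prob (?A n)" by (auto simp: eventually_sequentially)
  then show ?thesis by (intro exI[of _ "real n"]) simp
qed

text \<open>Half of the exponential rate is spent on the moment: with \<open>c\<^sub>2 = 2 a\<close>, the shell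
\<open>k + 1 < \<bar>x\<bar> \<le> k + 2\<close> contributes at most \<open>exp (a (k + 2)) * c\<^sub>1 exp (- 2 a (k + 1)) = c\<^sub>1 exp (- a k)\<close>
to the integral of \<open>exp (a \<bar>x\<bar>)\<close>, which dominates the square.\<close>

lemma integrable_square_if_exponential_tail:
  assumes c: "0 < c2" and tail: "\<And>t. t > 0 \<Longrightarrow> prob {x. \<bar>x\<bar> > t} \<le> c1 * exp (- c2 * t)"
  shows "integrable M (\<lambda>x. x\<^sup>2)"
proof -
  define a where "a = c2 / 2"
  have a: "a > 0" "c2 = 2 * a" using c by (simp_all add: a_def)
  let ?A = "\<lambda>k. {x. \<bar>x\<bar> > real k + 1}"
  have c1: "0 \<le> c1"
    using order_trans[OF measure_nonneg tail[of 1]] by (simp add: zero_le_mult_iff)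
  have A [measurable]: "?A k \<in> sets borel" for k by measurable
  have pw: "ennreal (exp (a * \<bar>x\<bar>))
      \<le> ennreal (exp a) + (\<Sum>k. ennreal (exp (a * (real k + 2))) * indicator (?A k) x)" for x
  proof (cases "\<bar>x\<bar> \<le> 1")
    case True
    then have "ennreal (exp (a * \<bar>x\<bar>)) \<le> ennreal (exp a)" using a by (intro ennreal_leI) simp
    then show ?thesis by (rule order_trans) simp
  next
    case False
    \<comment> \<open>the index of the shell \<open>k + 1 < \<bar>x\<bar> \<le> k + 2\<close> that contains \<open>x\<close>\<close>
    define k where "k = nat (\<lceil>\<bar>x\<bar>\<rceil> - 2)"
    have "\<lceil>\<bar>x\<bar>\<rceil> \<ge> 2" using False by linarith
    then have "real k = of_int \<lceil>\<bar>x\<bar>\<rceil> - 2" by (simp add: k_def)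
    then have k: "\<bar>x\<bar> > real k + 1" "\<bar>x\<bar> \<le> real k + 2" by linarith+
    have "ennreal (exp (a * \<bar>x\<bar>)) \<le> ennreal (exp (a * (real k + 2))) * indicator (?A k) x"
      using a k by (auto intro!: ennreal_leI)
    also have "\<dots> \<le> (\<Sum>k. ennreal (exp (a * (real k + 2))) * indicator (?A k) x)" (is "?g k \<le> suminf ?g")
    proof -
      have "sum ?g {k} \<le> suminf ?g" by (rule sum_le_suminf) auto
      then show ?thesis by (simp only: sum.insert[OF finite.emptyI] empty_iff not_False_eq_True sum.empty add_0_right)
    qed
    also have "\<dots> \<le> ennreal (exp a) + \<dots>" by simp
    finally show ?thesis .
  qed
  have "(\<integral>\<^sup>+x. ennreal (exp (a * \<bar>x\<bar>)) \<partial>M)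
      \<le> (\<integral>\<^sup>+x. ennreal (exp a) + (\<Sum>k. ennreal (exp (a * (real k + 2))) * indicator (?A k) x) \<partial>M)"
    by (intro nn_integral_mono pw)
  also have "\<dots> = ennreal (exp a) + (\<Sum>k. ennreal (exp (a * (real k + 2))) * emeasure M (?A k))"
    by (subst nn_integral_add) (auto simp: nn_integral_suminf nn_integral_cmult_indicator emeasure_space_1 simp del: space_eq_univ)
  also have "(\<Sum>k. ennreal (exp (a * (real k + 2))) * emeasure M (?A k)) \<le> (\<Sum>k. ennreal (c1 * exp (- a) ^ k))"
  proof (rule suminf_le[OF _ summableI summableI])
    fix k
    have "exp (a * (real k + 2)) * prob (?A k) \<le> exp (a * (real k + 2)) * (c1 * exp (- c2 * (real k + 1)))"
      by (intro mult_left_mono tail) auto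
    also have "\<dots> = c1 * exp (a * (real k + 2) + (- c2 * (real k + 1)))"
      by (simp only: exp_add mult_ac)
    also have "a * (real k + 2) + (- c2 * (real k + 1)) = real k * (- a)"
      by (simp add: a(2) algebra_simps)
    also have "exp (real k * (- a)) = exp (- a) ^ k" by (rule exp_of_nat_mult)
    finally show "ennreal (exp (a * (real k + 2))) * emeasure M (?A k) \<le> ennreal (c1 * exp (- a) ^ k)"
      by (simp add: emeasure_eq_measure ennreal_leI flip: ennreal_mult)
  qed
  also have "(\<Sum>k. ennreal (c1 * exp (- a) ^ k)) = ennreal (\<Sum>k. c1 * exp (- a) ^ k)"
    using a c1 by (intro suminf_ennreal2 summable_mult summable_geometric) auto
  finally have fin: "(\<integral>\<^sup>+x. ennreal (exp (a * \<bar>x\<bar>)) \<partial>M) < \<infinity>"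
    by (auto simp: less_top[symmetric] top_unique add_left_mono)
  have "integrable M (\<lambda>x. exp (a * \<bar>x\<bar>))"
    using fin by (intro integrableI_nonneg) auto
  then have "integrable M (\<lambda>x. 2 / a\<^sup>2 * exp (a * \<bar>x\<bar>))" by (rule integrable_mult_right)
  then show ?thesis
  proof (rule Bochner_Integration.integrable_bound)
    have "x\<^sup>2 \<le> 2 / a\<^sup>2 * exp (a * \<bar>x\<bar>)" for x
    proof -
      have "0 \<le> a * \<bar>x\<bar>" using a by simp
      from exp_lower_Taylor_quadratic[OF this] this
      have "(a * \<bar>x\<bar>)\<^sup>2 / 2 \<le> exp (a * \<bar>x\<bar>)" by linarith
      then show ?thesis using a by (simp add: power_mult_distrib field_simps)
    qed
    then show "AE x in M. norm (x\<^sup>2) \<le> norm (2 / a\<^sup>2 * exp (a * \<bar>x\<bar>))" by simp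
  qed simp
qed

end

section \<open>Deviations of the likelihood and the rate\<close>

text \<open>Markov's inequality for the product of the square roots, whose expectation is
\<open>(E (sqrt u)) ^ n \<le> (1 - \<delta>) ^ n \<le> exp (- n \<delta>)\<close>.  The slack \<open>-1\<close> in the event makes room for
replacing a density by a neighbour in the net.\<close>

lemma (in prob_space) iid_log_sum_tail:
  assumes ind: "indep_vars (\<lambda>_. borel) X {1..n}"
    and dist: "\<And>i. i \<in> {1..n} \<Longrightarrow> distr M borel (X i) = P"
    and u: "u \<in> borel_measurable borel" "\<And>x. 0 < u x"
    and int: "integrable P (\<lambda>x. sqrt (u x))" and le: "(\<integral>x. sqrt (u x) \<partial>P) \<le> 1 - \<delta>"
  shows "{\<omega> \<in> space M. - 1 \<le> (\<Sum>i=1..n. ln (u (X i \<omega>)))} \<in> events"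
    and "prob {\<omega> \<in> space M. - 1 \<le> (\<Sum>i=1..n. ln (u (X i \<omega>)))} \<le> exp (1 / 2 - real n * \<delta>)"
proof -
  note [measurable] = u(1)
  have X [measurable]: "X i \<in> borel_measurable M" if "i \<in> {1..n}" for i
    using ind that by (auto simp: indep_vars_def)
  let ?W = "\<lambda>\<omega>. \<Prod>i=1..n. sqrt (u (X i \<omega>))"
  have sq: "(\<lambda>x. sqrt (u x)) \<in> borel_measurable borel" by measurable
  have one: "integrable M (\<lambda>\<omega>. sqrt (u (X i \<omega>)))" "(\<integral>\<omega>. sqrt (u (X i \<omega>)) \<partial>M) = (\<integral>x. sqrt (u x) \<partial>P)"
    if i: "i \<in> {1..n}" for i
    using int integrable_distr_eq[OF X[OF i] sq] integral_distr[OF X[OF i] sq] dist[OF i] by simp_all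
  have indW: "indep_vars (\<lambda>_. borel) (\<lambda>i \<omega>. sqrt (u (X i \<omega>))) {1..n}"
    by (rule indep_vars_compose2[OF ind sq])
  have W: "integrable M ?W" "(\<integral>\<omega>. ?W \<omega> \<partial>M) = (\<Prod>i=1..n. \<integral>x. sqrt (u x) \<partial>P)"
    using indep_vars_integrable[OF _ indW one(1)] indep_vars_lebesgue_integral[OF _ indW one(1)] one(2)
    by simp_all
  have exp_W: "?W \<omega> = exp (1 / 2 * (\<Sum>i=1..n. ln (u (X i \<omega>))))" for \<omega>
  proof -
    have "sqrt (u x) = exp (1 / 2 * ln (u x))" for x
      using u(2)[of x] by (simp add: ln_sqrt[symmetric])
    then show ?thesis by (simp add: sum_distrib_left exp_sum)
  qed
  have eq: "{\<omega> \<in> space M. - 1 \<le> (\<Sum>i=1..n. ln (u (X i \<omega>)))} = {\<omega> \<in> space M. exp (- 1 / 2) \<le> ?W \<omega>}"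
    unfolding exp_W by auto
  show "{\<omega> \<in> space M. - 1 \<le> (\<Sum>i=1..n. ln (u (X i \<omega>)))} \<in> events"
    unfolding eq using borel_measurable_integrable[OF W(1)] by measurable
  have "0 \<le> ?W \<omega>" for \<omega> using u(2) by (intro prod_nonneg) (simp add: less_imp_le)
  then have "prob {\<omega> \<in> space M. exp (- 1 / 2) \<le> ?W \<omega>} \<le> (\<integral>\<omega>. ?W \<omega> \<partial>M) / exp (- 1 / 2)"
    by (intro integral_Markov_inequality_measure[OF W(1) sets.top]) auto
  also have "\<dots> = exp (1 / 2) * (\<integral>x. sqrt (u x) \<partial>P) ^ n"
    unfolding W(2) by (simp add: exp_minus field_simps)
  also have "\<dots> \<le> exp (1 / 2) * exp (- \<delta>) ^ n"
  proof (intro mult_left_mono power_mono)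
    show "(\<integral>x. sqrt (u x) \<partial>P) \<le> exp (- \<delta>)"
      using le exp_ge_add_one_self[of "- \<delta>"] by linarith
    show "0 \<le> (\<integral>x. sqrt (u x) \<partial>P)" using u(2) by (intro Bochner_Integration.integral_nonneg) (auto intro: less_imp_le)
  qed simp
  also have "\<dots> = exp (1 / 2 - real n * \<delta>)"
    by (simp add: exp_of_nat_mult[symmetric] flip: exp_add)
  finally show "prob {\<omega> \<in> space M. - 1 \<le> (\<Sum>i=1..n. ln (u (X i \<omega>)))} \<le> exp (1 / 2 - real n * \<delta>)"
    unfolding eq .
qed

text \<open>The exceptional event consists of the samples that leave \<open>[-T, T]\<close> and, for each point of a net of the set
of mixing distributions with divergence at least \<open>\<delta>\<close>, of the samples at which that point nearly beats
\<open>H\<^sub>0\<close>.  Off this event no \<open>H\<close> with divergence at least \<open>\<delta>\<close> is as likely as \<open>H\<^sub>0\<close>: otherwise its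
neighbour in the net, whose density is smaller by a factor of at most \<open>1 + 1/n \<le> exp (1/n)\<close> at each of the \<open>n\<close>
observations, would lose at most \<open>1\<close> in log likelihood.  The event is measurable although the divergence of
the estimator need not be.\<close>

lemma (in mixture_fit) likelihood_deviation:
  assumes M: "prob_space M" and ind: "prob_space.indep_vars M (\<lambda>_. borel) X {1..n}"
    and dist: "\<And>i. i \<in> {1..n} \<Longrightarrow> distr M borel (X i) = P" and n: "n \<ge> 1"
    and opt: "H\<^sub>0 \<in> mixing" "\<And>K. K \<in> mixing \<Longrightarrow> log_score K \<le> log_score H\<^sub>0"
    and N: "0 < N" and m: "exp 2 * (T * L / \<sigma>\<^sup>2) \<le> real m"
    and mesh: "(1 / real N + 2 * exp (- real m)) * exp (2 * (T * L / \<sigma>\<^sup>2) + L\<^sup>2 / (2 * \<sigma>\<^sup>2)) \<le> 1 / real n"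
  shows "\<exists>A \<in> sets M.
    measure M A \<ge> 1 - (real n * prob {x. \<bar>x\<bar> > T} + real ((2 * N + 1) ^ m) * exp (1 / 2 - real n * \<delta>)) \<and>
    (\<forall>\<omega>\<in>A. \<forall>H\<in>mixing. (\<Sum>i=1..n. ln (mix H\<^sub>0 (X i \<omega>))) \<le> (\<Sum>i=1..n. ln (mix H (X i \<omega>))) \<longrightarrow>
       1 / 2 * (\<integral>\<^sup>+x. ennreal ((sqrt (mix H x / mix H\<^sub>0 x) - 1)\<^sup>2) \<partial>P) < ennreal \<delta>)"
proof -
  interpret M: prob_space M by (rule M)
  define S where "S = {H \<in> mixing. ennreal \<delta> \<le> 1 / 2 * (\<integral>\<^sup>+x. ennreal ((sqrt (mix H x / mix H\<^sub>0 x) - 1)\<^sup>2) \<partial>P)}"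
  obtain J where J: "J \<subseteq> S" "finite J" "card J \<le> (2 * N + 1) ^ m"
    and net: "\<And>H. H \<in> S \<Longrightarrow> \<exists>j\<in>J. \<forall>k<m. \<bar>gauss_coeff \<sigma> L H k - gauss_coeff \<sigma> L j k\<bar> \<le> 1 / real N"
    using finite_mesh_net[OF N, of S m "gauss_coeff \<sigma> L"] gauss_coeff_integrable(2)[OF mixingD(1,2) L_pos]
    by (auto simp: S_def)
  have X [measurable]: "X i \<in> borel_measurable M" if "i \<in> {1..n}" for i
    using ind that by (auto simp: M.indep_vars_def)
  define E where "E j = {\<omega> \<in> space M. - 1 \<le> (\<Sum>i=1..n. ln (mix j (X i \<omega>) / mix H\<^sub>0 (X i \<omega>)))}" for j
  define U where "U i = X i -` {x. \<bar>x\<bar> > T} \<inter> space M" for i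
  have E: "E j \<in> sets M" "measure M (E j) \<le> exp (1 / 2 - real n * \<delta>)" if "j \<in> J" for j
  proof -
    let ?u = "\<lambda>x. mix j x / mix H\<^sub>0 x"
    have j: "j \<in> mixing" "ennreal \<delta> \<le> 1 / 2 * (\<integral>\<^sup>+x. ennreal ((sqrt (?u x) - 1)\<^sup>2) \<partial>P)"
      using that J(1) by (auto simp: S_def)
    note [measurable] = mix_measurable[OF j(1)] mix_measurable[OF opt(1)]
    have u: "0 < ?u x" for x using mixingD(3)[OF j(1)] mixingD(3)[OF opt(1)] by simp
    have u_meas: "?u \<in> borel_measurable borel" by measurable
    have "?u \<in> borel_measurable P" by measurable
    note sq = expectation_sqrt_le[OF this less_imp_le[OF u] likelihood_ratio_integral_le_1[OF opt j(1)] j(2)]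
    show "E j \<in> sets M" "measure M (E j) \<le> exp (1 / 2 - real n * \<delta>)"
      unfolding E_def using M.iid_log_sum_tail[OF ind dist u_meas u sq] by simp_all
  qed
  have tail_meas: "{x. \<bar>x\<bar> > T} \<in> sets borel" by measurable
  have U: "U i \<in> sets M" "measure M (U i) = prob {x. \<bar>x\<bar> > T}" if "i \<in> {1..n}" for i
  proof -
    show "U i \<in> sets M" unfolding U_def by (rule measurable_sets[OF X[OF that] tail_meas])
    show "measure M (U i) = prob {x. \<bar>x\<bar> > T}"
      using measure_distr[OF X[OF that] tail_meas] dist[OF that] by (simp add: U_def)
  qed
  define Bad where "Bad = (\<Union>i\<in>{1..n}. U i) \<union> (\<Union>j\<in>J. E j)"
  have sets: "(\<Union>i\<in>{1..n}. U i) \<in> sets M" "(\<Union>j\<in>J. E j) \<in> sets M"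
    using U(1) E(1) J(2) by auto
  have "measure M Bad \<le> measure M (\<Union>i\<in>{1..n}. U i) + measure M (\<Union>j\<in>J. E j)"
    unfolding Bad_def by (rule measure_Un_le[OF sets])
  also have "measure M (\<Union>i\<in>{1..n}. U i) \<le> (\<Sum>i\<in>{1..n}. measure M (U i))"
    using U(1) by (intro measure_UNION_le) auto
  also have "\<dots> = real n * prob {x. \<bar>x\<bar> > T}" using U(2) by simp
  also have "measure M (\<Union>j\<in>J. E j) \<le> (\<Sum>j\<in>J. measure M (E j))"
    using E(1) J(2) by (intro measure_UNION_le) auto
  also have "\<dots> \<le> (\<Sum>j\<in>J. exp (1 / 2 - real n * \<delta>))" by (intro sum_mono E(2))
  also have "\<dots> = real (card J) * exp (1 / 2 - real n * \<delta>)" by simp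
  also have "\<dots> \<le> real ((2 * N + 1) ^ m) * exp (1 / 2 - real n * \<delta>)"
    by (intro mult_right_mono of_nat_mono J(3)) simp
  finally have Bad: "measure M Bad \<le> real n * prob {x. \<bar>x\<bar> > T} + real ((2 * N + 1) ^ m) * exp (1 / 2 - real n * \<delta>)"
    by simp
  have Bad_sets: "Bad \<in> sets M" unfolding Bad_def by (rule sets.Un[OF sets])
  show ?thesis
  proof (intro bexI[of _ "space M - Bad"] conjI ballI impI)
    show "1 - (real n * prob {x. \<bar>x\<bar> > T} + real ((2 * N + 1) ^ m) * exp (1 / 2 - real n * \<delta>))
        \<le> measure M (space M - Bad)"
      using Bad M.prob_compl[OF Bad_sets] by linarith
    show "space M - Bad \<in> sets M" using Bad_sets by auto
    fix \<omega> H
    assume \<omega>: "\<omega> \<in> space M - Bad" and H: "H \<in> mixing"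
      and lik: "(\<Sum>i=1..n. ln (mix H\<^sub>0 (X i \<omega>))) \<le> (\<Sum>i=1..n. ln (mix H (X i \<omega>)))"
    show "1 / 2 * (\<integral>\<^sup>+x. ennreal ((sqrt (mix H x / mix H\<^sub>0 x) - 1)\<^sup>2) \<partial>P) < ennreal \<delta>"
    proof (rule ccontr)
      assume "\<not> ?thesis"
      then have "H \<in> S" using H by (simp add: S_def not_less)
      then obtain j where j: "j \<in> J" "\<And>k. k < m \<Longrightarrow> \<bar>gauss_coeff \<sigma> L H k - gauss_coeff \<sigma> L j k\<bar> \<le> 1 / real N"
        using net by blast
      have jm: "j \<in> mixing" using j J(1) by (auto simp: S_def)
      have "ln (mix H (X i \<omega>)) \<le> 1 / real n + ln (mix j (X i \<omega>))" if i: "i \<in> {1..n}" for i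
      proof -
        have "\<bar>X i \<omega>\<bar> \<le> T" using \<omega> i by (auto simp: Bad_def U_def not_less)
        then have "\<bar>X i \<omega>\<bar> * L / \<sigma>\<^sup>2 \<le> T * L / \<sigma>\<^sup>2"
          using L_pos by (intro divide_right_mono mult_right_mono) auto
        from gauss_mixture_ratio_le[OF mixingD(1,2)[OF H] mixingD(1,2)[OF jm] L_pos \<sigma>_pos this m _ j(2) mesh]
        have "mix H (X i \<omega>) \<le> (1 + 1 / real n) * mix j (X i \<omega>)" by simp
        also have "\<dots> \<le> exp (1 / real n) * mix j (X i \<omega>)"
          using mixingD(3)[OF jm] exp_ge_add_one_self[of "1 / real n"] by (intro mult_right_mono) (auto intro: less_imp_le)
        finally have "ln (mix H (X i \<omega>)) \<le> ln (exp (1 / real n) * mix j (X i \<omega>))"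
          using mixingD(3)[OF H] by (intro ln_mono) auto
        then show ?thesis using mixingD(3)[OF jm] by (simp add: ln_mult_pos)
      qed
      then have "(\<Sum>i=1..n. ln (mix H (X i \<omega>))) \<le> (\<Sum>i=1..n. 1 / real n + ln (mix j (X i \<omega>)))"
        by (intro sum_mono) auto
      also have "\<dots> = 1 + (\<Sum>i=1..n. ln (mix j (X i \<omega>)))"
        using n by (simp add: sum.distrib)
      finally have "- 1 \<le> (\<Sum>i=1..n. ln (mix j (X i \<omega>))) - (\<Sum>i=1..n. ln (mix H\<^sub>0 (X i \<omega>)))"
        using lik by linarith
      also have "\<dots> = (\<Sum>i=1..n. ln (mix j (X i \<omega>) / mix H\<^sub>0 (X i \<omega>)))"
        using mixingD(3)[OF jm] mixingD(3)[OF opt(1)] by (simp add: ln_divide_pos sum_subtractf)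
      finally have "\<omega> \<in> E j" using \<omega> by (simp add: E_def)
      then show False using \<omega> j(1) by (auto simp: Bad_def)
    qed
  qed
qed

text \<open>With \<open>l = log n\<close>, a number of coefficients \<open>m \<approx> q l\<close> and a mesh \<open>1 / N \<approx> exp (- q l)\<close> suffice when
\<open>q\<close> is large: both error terms are then of order \<open>exp (- q l)\<close>, which beats the loss
\<open>exp (2 a l + b)\<close> in the ratio bound and the tolerance \<open>1 / n = exp (- l)\<close>.  The net has about
\<open>N ^ m \<approx> exp (q\<^sup>2 l\<^sup>2)\<close> points.\<close>

lemma log_squared_net_size:
  fixes a b :: real
  assumes a: "0 \<le> a" and b: "0 \<le> b"
  shows "\<exists>C\<ge>0. \<forall>n\<ge>3. \<exists>m N. 0 < N \<and> exp 2 * (a * ln (real n)) \<le> real m \<and>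
    (1 / real N + 2 * exp (- real m)) * exp (2 * (a * ln (real n)) + b) \<le> 1 / real n \<and>
    real ((2 * N + 1) ^ m) \<le> exp (C * (ln (real n))\<^sup>2)"
proof -
  \<comment> \<open>the terms serve, in order, the Taylor condition, the two exponents of the ratio bound, and the constant factor \<open>3 \<le> exp 2\<close> together with the tolerance \<open>exp (- l)\<close>\<close>
  define q where "q = exp 2 * a + 2 * a + b + 3"
  have ea: "0 \<le> exp 2 * a" using a by simp
  have q: "q \<ge> 3" "exp 2 * a \<le> q" "2 * a + b + 3 \<le> q" using a b ea unfolding q_def by linarith+
  show ?thesis
  proof (intro exI[of _ "(q + 2)\<^sup>2"] conjI allI impI)
    fix n :: nat assume n: "3 \<le> n"
    define l where "l = ln (real n)"
    have "exp 1 \<le> real n" using exp_le n by linarith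
    then have l: "1 \<le> l" using n unfolding l_def by (subst ln_ge_iff) auto
    have exp_l: "exp l = real n" using n by (simp add: l_def)
    define m where "m = nat \<lceil>q * l\<rceil>"
    define N where "N = nat \<lceil>exp (q * l)\<rceil>"
    have ql: "0 \<le> q * l" using q l by simp
    have m: "q * l \<le> real m" "real m \<le> q * l + 1" using ql unfolding m_def by linarith+
    have e0: "exp (q * l) > 0" by simp
    then have N: "exp (q * l) \<le> real N" "real N \<le> exp (q * l) + 1" unfolding N_def by linarith+
    have e2: "5 \<le> exp (2 :: real)" using exp_lower_Taylor_quadratic[of 2] by simp
    have c1: "0 < N" using N(1) e0 by linarith
    have "exp 2 * a * l \<le> q * l" using q l by (intro mult_right_mono) auto
    then have c2: "exp 2 * (a * l) \<le> real m" using m by (simp add: mult.assoc)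
    have "1 / real N \<le> exp (- (q * l))"
      using N(1) e0 c1 by (simp add: exp_minus field_simps)
    moreover have "exp (- real m) \<le> exp (- (q * l))" using m by simp
    ultimately have "1 / real N + 2 * exp (- real m) \<le> 3 * exp (- (q * l))" by linarith
    also have "\<dots> \<le> exp 2 * exp (- (q * l))" using e2 by (intro mult_right_mono) auto
    finally have "(1 / real N + 2 * exp (- real m)) * exp (2 * (a * l) + b)
        \<le> exp 2 * exp (- (q * l)) * exp (2 * (a * l) + b)"
      by (intro mult_right_mono) auto
    also have "\<dots> = exp (2 + b + 2 * a * l - q * l)" by (simp flip: exp_add add: algebra_simps)
    also have "\<dots> \<le> exp (- l)"
    proof -
      have "(2 * a + b + 3) * l \<le> q * l" using q l by (intro mult_right_mono) auto
      moreover have "(2 + b) * 1 \<le> (2 + b) * l" using l b by (intro mult_left_mono) auto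
      ultimately show ?thesis by (simp add: algebra_simps)
    qed
    also have "\<dots> = 1 / real n" by (simp add: exp_minus exp_l field_simps)
    finally have c3: "(1 / real N + 2 * exp (- real m)) * exp (2 * (a * l) + b) \<le> 1 / real n" .
    have q2l: "q * l + 2 \<le> (q + 2) * l" using l by (simp add: algebra_simps)
    have "1 \<le> exp (q * l)" using ql by simp
    moreover have "real (2 * N + 1) = 2 * real N + 1" by simp
    ultimately have "real (2 * N + 1) \<le> 5 * exp (q * l)" using N by linarith
    also have "\<dots> \<le> exp 2 * exp (q * l)" using e2 by (intro mult_right_mono) auto
    also have "\<dots> = exp (q * l + 2)" by (simp add: exp_add)
    also have "\<dots> \<le> exp ((q + 2) * l)" using q2l by simp
    finally have "real ((2 * N + 1) ^ m) \<le> exp ((q + 2) * l) ^ m"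
      unfolding of_nat_power by (intro power_mono) auto
    also have "\<dots> = exp (real m * ((q + 2) * l))" by (simp add: exp_of_nat_mult)
    also have "\<dots> \<le> exp (((q + 2) * l) * ((q + 2) * l))"
      using m q2l q l by (subst exp_le_cancel_iff) (intro mult_right_mono, auto)
    also have "\<dots> = exp ((q + 2)\<^sup>2 * l\<^sup>2)" by (simp add: power2_eq_square mult_ac)
    finally show "\<exists>m N. 0 < N \<and> exp 2 * (a * ln (real n)) \<le> real m \<and>
      (1 / real N + 2 * exp (- real m)) * exp (2 * (a * ln (real n)) + b) \<le> 1 / real n \<and>
      real ((2 * N + 1) ^ m) \<le> exp ((q + 2)\<^sup>2 * (ln (real n))\<^sup>2)"
      using c1 c2 c3 unfolding l_def by blast
  qed simp
qed

text \<open>With \<open>T = (2 / c\<^sub>2) log n\<close> some observation leaves \<open>[-T, T]\<close> with probability at most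
\<open>n c\<^sub>1 n\<^sup>-\<^sup>2\<close>.  The excess of \<open>n \<delta>\<close> over the log size of the net is \<open>(log n)\<^sup>2 \<ge> log n\<close>, so the net
contributes at most \<open>exp (1/2) / n\<close>.\<close>

lemma (in mixture_fit) likelihood_rate:
  assumes c2: "0 < c2" and tail: "\<And>t. t > 0 \<Longrightarrow> prob {x. \<bar>x\<bar> > t} \<le> c1 * exp (- c2 * t)"
    and opt: "H\<^sub>0 \<in> mixing" "\<And>K. K \<in> mixing \<Longrightarrow> log_score K \<le> log_score H\<^sub>0"
  shows "\<exists>C>0. \<forall>n\<ge>3. \<forall>M X. prob_space M \<longrightarrow> prob_space.indep_vars M (\<lambda>_. borel) X {1..n} \<longrightarrow>
    (\<forall>i\<in>{1..n}. distr M borel (X i) = P) \<longrightarrow>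
    (\<exists>A \<in> sets M. measure M A \<ge> 1 - (c1 + 2) / real n \<and>
      (\<forall>\<omega>\<in>A. \<forall>H\<in>mixing. (\<Sum>i=1..n. ln (mix H\<^sub>0 (X i \<omega>))) \<le> (\<Sum>i=1..n. ln (mix H (X i \<omega>))) \<longrightarrow>
        1 / 2 * (\<integral>\<^sup>+x. ennreal ((sqrt (mix H x / mix H\<^sub>0 x) - 1)\<^sup>2) \<partial>P)
          \<le> ennreal (C * (ln (real n))\<^sup>2 / real n)))"
proof -
  define a where "a = 2 / c2 * L / \<sigma>\<^sup>2"
  have a: "0 \<le> a" using c2 L_pos by (simp add: a_def)
  obtain C where C: "C \<ge> 0" and size: "\<And>n. n \<ge> 3 \<Longrightarrow> \<exists>m N. 0 < N \<and> exp 2 * (a * ln (real n)) \<le> real m \<and>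
      (1 / real N + 2 * exp (- real m)) * exp (2 * (a * ln (real n)) + L\<^sup>2 / (2 * \<sigma>\<^sup>2)) \<le> 1 / real n \<and>
      real ((2 * N + 1) ^ m) \<le> exp (C * (ln (real n))\<^sup>2)"
    using log_squared_net_size[OF a, of "L\<^sup>2 / (2 * \<sigma>\<^sup>2)"] by auto
  show ?thesis
  proof (intro exI[of _ "C + 1"] conjI allI impI)
    show "0 < C + 1" using C by simp
    fix n :: nat and M :: "'b measure" and X
    assume n: "3 \<le> n" and M: "prob_space M" and ind: "prob_space.indep_vars M (\<lambda>_. borel) X {1..n}"
      and dist: "\<forall>i\<in>{1..n}. distr M borel (X i) = P"
    define l where "l = ln (real n)"
    have "exp 1 \<le> real n" using exp_le n by linarith
    then have l: "1 \<le> l" using n unfolding l_def by (subst ln_ge_iff) auto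
    have exp_l: "exp l = real n" using n by (simp add: l_def)
    define T where "T = 2 / c2 * l"
    have T: "0 < T" using c2 l by (simp add: T_def)
    have TL: "T * L / \<sigma>\<^sup>2 = a * l" by (simp add: T_def a_def)
    define \<delta> where "\<delta> = (C + 1) * l\<^sup>2 / real n"
    obtain m N where N: "0 < N" and m: "exp 2 * (a * l) \<le> real m"
      and mesh: "(1 / real N + 2 * exp (- real m)) * exp (2 * (a * l) + L\<^sup>2 / (2 * \<sigma>\<^sup>2)) \<le> 1 / real n"
      and card: "real ((2 * N + 1) ^ m) \<le> exp (C * l\<^sup>2)"
      using size[OF n] unfolding l_def by blast
    obtain A where A: "A \<in> sets M"
      "measure M A \<ge> 1 - (real n * prob {x. \<bar>x\<bar> > T} + real ((2 * N + 1) ^ m) * exp (1 / 2 - real n * \<delta>))"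
      "\<forall>\<omega>\<in>A. \<forall>H\<in>mixing. (\<Sum>i=1..n. ln (mix H\<^sub>0 (X i \<omega>))) \<le> (\<Sum>i=1..n. ln (mix H (X i \<omega>))) \<longrightarrow>
       1 / 2 * (\<integral>\<^sup>+x. ennreal ((sqrt (mix H x / mix H\<^sub>0 x) - 1)\<^sup>2) \<partial>P) < ennreal \<delta>"
      using likelihood_deviation[OF M ind _ _ opt N m[folded TL] mesh[folded TL], of \<delta>] dist n by auto
    have "exp (- c2 * T) = exp (- l) * exp (- l)"
      using c2 by (simp add: T_def flip: exp_add)
    also have "\<dots> = 1 / (real n * real n)" by (simp add: exp_minus exp_l field_simps)
    finally have "real n * prob {x. \<bar>x\<bar> > T} \<le> real n * (c1 * (1 / (real n * real n)))"
      using tail[OF T] by (intro mult_left_mono) auto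
    also have "\<dots> = c1 / real n" using n by (simp add: field_simps)
    finally have 1: "real n * prob {x. \<bar>x\<bar> > T} \<le> c1 / real n" .
    have "real ((2 * N + 1) ^ m) * exp (1 / 2 - real n * \<delta>) \<le> exp (C * l\<^sup>2) * exp (1 / 2 - real n * \<delta>)"
      by (intro mult_right_mono card) simp
    also have "\<dots> = exp (1 / 2) * exp (- l\<^sup>2)"
    proof -
      have "real n * \<delta> = (C + 1) * l\<^sup>2" using n by (simp add: \<delta>_def)
      then show ?thesis by (simp add: algebra_simps flip: exp_add)
    qed
    also have "\<dots> \<le> 2 * exp (- l)"
    proof (intro mult_mono)
      show "exp (1 / 2 :: real) \<le> 2" by (rule exp_half_le2)
      show "exp (- l\<^sup>2) \<le> exp (- l)" using l mult_right_mono[of 1 l l] by (simp add: power2_eq_square)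
    qed auto
    also have "\<dots> = 2 / real n" by (simp add: exp_minus exp_l field_simps)
    finally have "1 - (c1 + 2) / real n \<le> measure M A"
      using 1 A(2) by (simp add: add_divide_distrib)
    with A show "\<exists>A \<in> sets M. measure M A \<ge> 1 - (c1 + 2) / real n \<and>
      (\<forall>\<omega>\<in>A. \<forall>H\<in>mixing. (\<Sum>i=1..n. ln (mix H\<^sub>0 (X i \<omega>))) \<le> (\<Sum>i=1..n. ln (mix H (X i \<omega>))) \<longrightarrow>
        1 / 2 * (\<integral>\<^sup>+x. ennreal ((sqrt (mix H x / mix H\<^sub>0 x) - 1)\<^sup>2) \<partial>P)
          \<le> ennreal ((C + 1) * (ln (real n))\<^sup>2 / real n))"
      unfolding \<delta>_def l_def by (intro bexI[of _ A]) (auto intro: less_imp_le)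
  qed
qed

lemma H0_sq_density:
  assumes [measurable]: "p \<in> borel_measurable borel" "f \<in> borel_measurable borel" "g \<in> borel_measurable borel"
    and p: "\<And>x. 0 \<le> p x"
  shows "H0_sq p f g = 1 / 2 * (\<integral>\<^sup>+x. ennreal ((sqrt (f x / g x) - 1)\<^sup>2) \<partial>density lborel p)"
  unfolding H0_sq_def using p
  by (subst nn_integral_density) (auto simp: ennreal_mult mult.commute)

text \<open>When both logarithms are integrable under the true law, the finite branch of the divergence applies and
splits.\<close>

lemma KL_ext_eq:
  assumes P: "P = density lborel p" and p: "p \<in> borel_measurable borel" "\<And>x. 0 < p x"
    and q: "q \<in> borel_measurable borel" "\<And>x. 0 < q x"
    and int: "integrable P (\<lambda>x. ln (p x))" "integrable P (\<lambda>x. ln (q x))"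
  shows "KL_ext p q = ereal ((\<integral>x. ln (p x) \<partial>P) - (\<integral>x. ln (q x) \<partial>P))"
proof -
  note [measurable] = p(1) q(1)
  have ln: "ln (p x / q x) = ln (p x) - ln (q x)" for x by (rule ln_divide_pos[OF p(2) q(2)])
  have "integrable P (\<lambda>x. ln (p x) - ln (q x))" using int by simp
  then have "integrable lborel (\<lambda>x. p x * ln (p x / q x))"
    unfolding P ln using p by (subst (asm) integrable_density) (auto intro: less_imp_le)
  moreover have "(\<integral>x. p x * ln (p x / q x) \<partial>lborel) = (\<integral>x. ln (p x) - ln (q x) \<partial>P)"
    unfolding P ln using p by (subst integral_density) (auto intro: less_imp_le)
  ultimately show ?thesis using int by (simp add: KL_ext_def)
qed

theorem theorem2p4:
  fixes c L c1 c2 :: real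
    and G :: "real measure"
    and M :: "nat \<Rightarrow> 'w measure"
    and \<theta> X :: "nat \<Rightarrow> nat \<Rightarrow> 'w \<Rightarrow> real"
    and Hhat :: "nat \<Rightarrow> 'w \<Rightarrow> real measure"
  assumes "c \<ge> 0" and "L > 0" and "G \<in> borel_probs UNIV"
    and model: "\<And>n. n \<ge> 1 \<Longrightarrow> normal_means_model (M n) n G (\<theta> n) (X n)"
    and "c1 > 0" and "c2 > 0"
    and tail: "\<And>t. t > 0 \<Longrightarrow>
      (\<integral>x. indicator {x. \<bar>x\<bar> > t} x * true_density G x \<partial>lborel) \<le> c1 * exp (- c2 * t)"
    and npmle: "\<And>n \<omega>. n \<ge> 1 \<Longrightarrow> \<omega> \<in> space (M n) \<Longrightarrow>
      is_npmle c L n (\<lambda>i. X n i \<omega>) (Hhat n \<omega>)"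
  shows "(\<forall>n\<ge>1. prob_space.indep_vars (M n) (\<lambda>_. borel) (X n) {1..n} \<and>
            (\<forall>i\<in>{1..n}. distributed (M n) lborel (X n i) (true_density G)))
       \<and> (\<exists>!f. pseudo_true c L G f)
       \<and> (\<exists>!H. H \<in> borel_probs {-L..L} \<and> pseudo_true c L G (model_density c H))
       \<and> (\<forall>Htilde. Htilde \<in> borel_probs {-L..L} \<and> pseudo_true c L G (model_density c Htilde) \<longrightarrow>
            bigO_prob M
              (\<lambda>n \<omega>. H0_sq (true_density G) (model_density c (Hhat n \<omega>)) (model_density c Htilde))
              (\<lambda>n. (ln (real n)) ^ 4 / real n))"
proof -
  interpret G: real_distribution G using assms(3) by (simp add: borel_probs_iff)
  define \<sigma> where "\<sigma> = sigma_star c"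
  have \<sigma>: "\<sigma> > 0" by (simp add: \<sigma>_def sigma_star_def add_pos_nonneg)
  let ?p = "true_density G"
  define P where "P = density lborel ?p"
  have p: "?p \<in> borel_measurable borel" "\<And>x. 0 < ?p x"
    using G.gauss_mixture_pos[of 1] by auto
  interpret P: real_distribution P
    unfolding P_def by (rule G.real_distribution_gauss_mixture) simp
  have tailP: "measure P {x. \<bar>x\<bar> > t} \<le> c1 * exp (- c2 * t)" if "t > 0" for t
  proof -
    have [measurable]: "{x :: real. \<bar>x\<bar> > t} \<in> sets borel" by measurable
    have "measure P {x. \<bar>x\<bar> > t} = (\<integral>x. indicator {x. \<bar>x\<bar> > t} x \<partial>P)" by simp
    also have "\<dots> = (\<integral>x. indicator {x. \<bar>x\<bar> > t} x * ?p x \<partial>lborel)"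
      unfolding P_def by (subst integral_density) (auto simp: mult.commute)
    finally show ?thesis using tail[OF that] by simp
  qed
  interpret mixture_fit P \<sigma> L
  proof
    show "integrable P (\<lambda>x. x\<^sup>2)"
      by (rule P.integrable_square_if_exponential_tail[OF \<open>c2 > 0\<close> tailP])
    show "AE x in lborel. Q x" if "AE x in P. Q x" for Q
      using that p unfolding P_def by (subst (asm) AE_density) auto
  qed (use \<sigma> \<open>L > 0\<close> in auto)
  have int_p: "integrable P (\<lambda>x. ln (?p x))"
  proof -
    obtain R where R: "1 / 2 \<le> G.prob {-R..R}" using G.half_mass_interval by blast
    have "integrable P (\<lambda>x. 1 + \<bar>ln (1 / sqrt (2 * pi * 1\<^sup>2))\<bar> + (x\<^sup>2 + R\<^sup>2) / 1\<^sup>2)"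
      by (intro Bochner_Integration.integrable_add integrable_divide integrable_sq P.integrable_const)
    then show ?thesis
    proof (rule Bochner_Integration.integrable_bound)
      show "AE x in P. norm (ln (?p x)) \<le> norm (1 + \<bar>ln (1 / sqrt (2 * pi * 1\<^sup>2))\<bar> + (x\<^sup>2 + R\<^sup>2) / 1\<^sup>2)"
        using G.abs_ln_gauss_mixture_le[OF zero_less_one R]
        by (intro AE_I2) (auto intro: order_trans[OF _ abs_ge_self])
    qed (use p in simp)
  qed
  have KL: "KL_ext ?p (mix H) = ereal ((\<integral>x. ln (?p x) \<partial>P) - log_score H)" if "H \<in> mixing" for H
    unfolding log_score_def
    by (rule KL_ext_eq[OF P_def p mix_measurable[OF that] mixingD(3)[OF that] int_p integrable_ln_mix[OF that]])
  have pt: "pseudo_true c L G (mix H) \<longleftrightarrow> (\<forall>K\<in>mixing. log_score K \<le> log_score H)" if "H \<in> mixing" for H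
    using that by (auto simp: pseudo_true_def is_arg_min_def model_class_def \<sigma>_def[symmetric] KL not_less)
  have pt_mix: "\<exists>H\<in>mixing. f = mix H" if "pseudo_true c L G f" for f
    using that by (auto simp: pseudo_true_def is_arg_min_def model_class_def \<sigma>_def[symmetric])
  obtain H\<^sub>0 where H0: "H\<^sub>0 \<in> mixing" "\<And>K. K \<in> mixing \<Longrightarrow> log_score K \<le> log_score H\<^sub>0"
    using log_score_maximizer_exists by blast
  have uniq: "H = H\<^sub>0" if "H \<in> mixing" "pseudo_true c L G (mix H)" for H
    using log_score_maximizer_unique[OF that(1) _ H0] pt[OF that(1)] that(2) by blast
  have pt0: "pseudo_true c L G (mix H\<^sub>0)" using pt H0 by blast
  have iid: "prob_space.indep_vars (M n) (\<lambda>_. borel) (X n) {1..n}"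
    "\<And>i. i \<in> {1..n} \<Longrightarrow> distributed (M n) lborel (X n i) ?p" if "n \<ge> 1" for n
    using normal_means_model_iid[OF model[OF that] assms(3) that] by auto
  have rate: "bigO_prob M (\<lambda>n \<omega>. H0_sq ?p (mix (Hhat n \<omega>)) (mix H\<^sub>0)) (\<lambda>n. (ln (real n)) ^ 4 / real n)"
    unfolding bigO_prob_def
  proof (intro allI impI)
    fix \<epsilon> :: real assume \<epsilon>: "\<epsilon> > 0"
    obtain C where C: "C > 0" and dev: "\<forall>n\<ge>3. \<forall>(N :: 'w measure) Y. prob_space N \<longrightarrow>
      prob_space.indep_vars N (\<lambda>_. borel) Y {1..n} \<longrightarrow> (\<forall>i\<in>{1..n}. distr N borel (Y i) = P) \<longrightarrow>
      (\<exists>A \<in> sets N. measure N A \<ge> 1 - (c1 + 2) / real n \<and>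
      (\<forall>\<omega>\<in>A. \<forall>H\<in>mixing. (\<Sum>i=1..n. ln (mix H\<^sub>0 (Y i \<omega>))) \<le> (\<Sum>i=1..n. ln (mix H (Y i \<omega>))) \<longrightarrow>
        1 / 2 * (\<integral>\<^sup>+x. ennreal ((sqrt (mix H x / mix H\<^sub>0 x) - 1)\<^sup>2) \<partial>P)
          \<le> ennreal (C * (ln (real n))\<^sup>2 / real n)))"
      by (rule exE[OF likelihood_rate[OF \<open>c2 > 0\<close> tailP H0]], assumption, assumption, elim conjE, rule that)
    show "\<exists>C>0. \<forall>\<^sub>F n in sequentially. \<exists>A\<in>sets (M n). 1 - \<epsilon> \<le> measure (M n) A \<and>
        (\<forall>\<omega>\<in>A. H0_sq ?p (mix (Hhat n \<omega>)) (mix H\<^sub>0) \<le> ennreal (C * ((ln (real n)) ^ 4 / real n)))"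
    proof (intro exI[of _ C] conjI C eventually_sequentiallyI)
      fix n assume n: "max 3 (nat \<lceil>(c1 + 2) / \<epsilon>\<rceil>) \<le> n"
      then have n3: "n \<ge> 3" and n1: "n \<ge> 1" by auto
      have "(c1 + 2) / \<epsilon> \<le> real n" using n by linarith
      then have small: "(c1 + 2) / real n \<le> \<epsilon>" using \<epsilon> n3 by (simp add: field_simps)
      have Mn: "prob_space (M n)" using model[OF n1] by (simp add: normal_means_model_def)
      have law: "distr (M n) borel (X n i) = P" if "i \<in> {1..n}" for i
        using iid(2)[OF n1 that] by (simp add: distributed_def P_def cong: distr_cong)
      obtain A where A: "A \<in> sets (M n)" "measure (M n) A \<ge> 1 - (c1 + 2) / real n"
        "\<forall>\<omega>\<in>A. \<forall>H\<in>mixing.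
          (\<Sum>i=1..n. ln (mix H\<^sub>0 (X n i \<omega>))) \<le> (\<Sum>i=1..n. ln (mix H (X n i \<omega>))) \<longrightarrow>
          1 / 2 * (\<integral>\<^sup>+x. ennreal ((sqrt (mix H x / mix H\<^sub>0 x) - 1)\<^sup>2) \<partial>P)
            \<le> ennreal (C * (ln (real n))\<^sup>2 / real n)"
        by (rule bexE[OF dev[rule_format, OF n3 Mn iid(1)[OF n1] law]], assumption, elim conjE, rule that)
      have "exp 1 \<le> real n" using exp_le n3 by linarith
      then have "1 \<le> ln (real n)" using n3 by (subst ln_ge_iff) auto
      then have "(ln (real n))\<^sup>2 \<le> (ln (real n)) ^ 4" by (intro power_increasing) auto
      then have le: "C * (ln (real n))\<^sup>2 / real n \<le> C * ((ln (real n)) ^ 4 / real n)"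
        using C by (simp add: divide_right_mono)
      show "\<exists>A\<in>sets (M n). 1 - \<epsilon> \<le> measure (M n) A \<and>
        (\<forall>\<omega>\<in>A. H0_sq ?p (mix (Hhat n \<omega>)) (mix H\<^sub>0) \<le> ennreal (C * ((ln (real n)) ^ 4 / real n)))"
      proof (intro bexI[of _ A] conjI ballI)
        show "1 - \<epsilon> \<le> measure (M n) A" using A(2) small by linarith
        fix \<omega> assume \<omega>: "\<omega> \<in> A"
        then have "\<omega> \<in> space (M n)" using sets.sets_into_space[OF A(1)] by blast
        from npmle[OF n1 this]
        have H: "Hhat n \<omega> \<in> mixing"
          "(\<Sum>i=1..n. ln (mix H\<^sub>0 (X n i \<omega>))) \<le> (\<Sum>i=1..n. ln (mix (Hhat n \<omega>) (X n i \<omega>)))"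
          using H0(1) by (auto simp: is_npmle_def \<sigma>_def)
        have "H0_sq ?p (mix (Hhat n \<omega>)) (mix H\<^sub>0)
            = 1 / 2 * (\<integral>\<^sup>+x. ennreal ((sqrt (mix (Hhat n \<omega>) x / mix H\<^sub>0 x) - 1)\<^sup>2) \<partial>P)"
          unfolding P_def
          by (rule H0_sq_density) (use p mix_measurable[OF H(1)] mix_measurable[OF H0(1)] in \<open>auto intro: less_imp_le\<close>)
        also have "\<dots> \<le> ennreal (C * (ln (real n))\<^sup>2 / real n)" by (rule A(3)[rule_format, OF \<omega> H])
        also have "\<dots> \<le> ennreal (C * ((ln (real n)) ^ 4 / real n))" using le by (rule ennreal_leI)
        finally show "H0_sq ?p (mix (Hhat n \<omega>)) (mix H\<^sub>0) \<le> ennreal (C * ((ln (real n)) ^ 4 / real n))" .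
      qed (rule A(1))
    qed
  qed
  have "\<exists>!f. pseudo_true c L G f"
    using pt0 pt_mix uniq by metis
  moreover have "\<exists>!H. H \<in> mixing \<and> pseudo_true c L G (mix H)"
    using pt0 H0(1) uniq by blast
  ultimately show ?thesis
    using iid rate uniq unfolding \<sigma>_def by blast
qed

end
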